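(* Suppose that assumptions (S), (L), (B), (W) of the context hold with constants $\mu,L,G,\beta$ and that $\beta<\mu/L$. Let $\tilde\mu:=\mu-L\beta$, and let the positive step sizes $\{\gamma_t\}_{t\ge1}$ be non-increasing and satisfy (i) $\frac{\gamma_{t-1}}{\gamma_t}\le 1+\frac{\mu-L\beta}{2}\gamma_t$ (for all $t\ge 2$) and (ii) $\gamma_t\le\frac{2}{\mu-L\beta}$ (for all $t\ge1$). Let $\{\theta_t\}_{t\ge0}$ be generated by the projected clipped SGD algorithm described in the context, with clipping threshold $c>0$ and noise level $\sigma_{\rm DP}\ge0$, let $\theta_{PS}$ be the performative stable solution, and let $\hat\theta_t:=\theta_t-\theta_{PS}$. Then for any $t\ge1$, $$\mathbb E\|\hat\theta_{t+1}\|^2\le\prod_{i=1}^{t+1}(1-\tilde\mu\gamma_i)\,\|\hat\theta_0\|^2+\frac{2c_1}{\tilde\mu}\gamma_{t+1}+\frac{8\,\mathcal C_1}{\tilde\mu^2},$$ where $c_1:=2(c^2+G^2)+d\,\sigma_{\rm DP}^2$ and $\mathcal C_1:=(\max\{G-c,0\})^2$.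
   Context: Setting. $\mathcal X\subseteq\mathbb R^d$ is closed and convex, $\mathsf Z$ is the sample space (a subset of a Euclidean space), $\ell(\theta;z)$ is a loss function differentiable in $\theta$, and for each $\theta\in\mathcal X$, $\mathcal D(\theta)$ is a probability distribution on $\mathsf Z$. $\nabla\ell(\theta;z)$ is the gradient in $\theta$. Write $f(\theta_1;\theta_2):=\mathbb E_{Z\sim\mathcal D(\theta_2)}[\ell(\theta_1;Z)]$; $\nabla f(\theta_1;\theta_2)$ is the gradient with respect to the first argument. $\|\cdot\|$ is the Euclidean norm. Performative stable solution: $\theta_{PS}\in\mathcal X$ is the point satisfying $\theta_{PS}=\arg\min_{\theta\in\mathcal X}\mathbb E_{Z\sim\mathcal D(\theta_{PS})}[\ell(\theta;Z)]$ (it is unique and well-defined under the assumptions below when $\beta<\mu/L$). Assumptions: (S) For every $\bar\theta\in\mathcal X$, $f(\cdot;\bar\theta)$ is $\mu$-strongly convex ($\mu>0$): $f(\theta';\bar\theta)\ge f(\theta;\bar\theta)+\langle\nabla f(\theta;\bar\theta),\theta'-\theta\rangle+\frac\mu2\|\theta'-\theta\|^2$ for all $\theta,\theta'\in\mathcal X$. (L) $\|\nabla\ell(\theta_1;z_1)-\nabla\ell(\theta_2;z_2)\|\le L(\|\theta_1-\theta_2\|+\|z_1-z_2\|)$ for all $\theta_1,\theta_2\in\mathcal X$, $z_1,z_2\in\mathsf Z$; and there is $\ell^\star>-\infty$ with $\ell(\theta;z)\ge\ell^\star$ for all $\theta\in\mathcal X$ (and all $z$). (B) $\sup_{\theta\in\mathcal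 X,z\in\mathsf Z}\|\nabla\ell(\theta;z)\|\le G$. (W) $W_1(\mathcal D(\theta),\mathcal D(\theta'))\le\beta\|\theta-\theta'\|$ for all $\theta,\theta'\in\mathcal X$, where $\beta\ge 0$ and $W_1(P,Q)=\inf_J\mathbb E_{(z,z')\sim J}[\|z-z'\|_1]$, the infimum being over all couplings $J$ of $P$ and $Q$. Clipping: $\mathrm{clip}_c(g):=\min\{1,c/\|g\|\}\,g$ for $g\in\mathbb R^d$. Projected clipped SGD (with greedy deployment): from a deterministic $\theta_0\in\mathcal X$, for $t\ge0$, given the past draw $Z_{t+1}\sim\mathcal D(\theta_t)$ and independent noise $\zeta_{t+1}\sim\mathcal N(0,\sigma_{\rm DP}^2I_d)$ (zero if $\sigma_{\rm DP}=0$), and set $\theta_{t+1}=\mathcal P_{\mathcal X}\big(\theta_t-\gamma_{t+1}(\mathrm{clip}_c(\nabla\ell(\theta_t;Z_{t+1}))+\zeta_{t+1})\big)$, where $\mathcal P_{\mathcal X}$ is Euclidean projection onto $\mathcal X$. *)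

theory Defs
  imports "HOL-Probability.Probability"
begin

definition gradient :: "('a::euclidean_space \<Rightarrow> real) \<Rightarrow> 'a \<Rightarrow> 'a" where
  "gradient h x = (THE v. GDERIV h x :> v)"

definition decoupled_risk ::
  "('a \<Rightarrow> 'z \<Rightarrow> real) \<Rightarrow> ('a \<Rightarrow> 'z measure) \<Rightarrow> 'a \<Rightarrow> 'a \<Rightarrow> real" where
  "decoupled_risk loss D \<theta>1 \<theta>2 = (\<integral>z. loss \<theta>1 z \<partial>(D \<theta>2))"

text \<open>
  The gradient of \<open>F\<close> is taken relative to \<open>X\<close>, because the expected loss is only under control on
  \<open>X\<close>. At points where \<open>F\<close> is differentiable in the ambient space, the ordinary gradient qualifies as
  \<open>v\<close>; and since \<open>X\<close> is convex, the numbers \<open>v \<bullet> (x' - x)\<close> do not depend on the choice of \<open>v\<close>.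
\<close>

definition strongly_convex_on :: "real \<Rightarrow> 'a::euclidean_space set \<Rightarrow> ('a \<Rightarrow> real) \<Rightarrow> bool" where
  "strongly_convex_on \<mu> X F \<longleftrightarrow>
    (\<forall>x\<in>X. \<exists>v. (F has_derivative (\<lambda>h. v \<bullet> h)) (at x within X) \<and>
      (\<forall>x'\<in>X. F x' \<ge> F x + v \<bullet> (x' - x) + \<mu> / 2 * (norm (x' - x))\<^sup>2))"

definition performatively_stable ::
  "'a set \<Rightarrow> ('a \<Rightarrow> 'z \<Rightarrow> real) \<Rightarrow> ('a \<Rightarrow> 'z measure) \<Rightarrow> 'a \<Rightarrow> bool" where
  "performatively_stable X loss D \<theta>PS \<longleftrightarrow>
    is_arg_min (\<lambda>\<theta>. decoupled_risk loss D \<theta> \<theta>PS) (\<lambda>\<theta>. \<theta> \<in> X) \<theta>PS"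

definition l1_norm :: "'z::euclidean_space \<Rightarrow> real" where
  "l1_norm z = (\<Sum>b\<in>Basis. \<bar>z \<bullet> b\<bar>)"

definition couplings :: "'z measure \<Rightarrow> 'z measure \<Rightarrow> ('z \<times> 'z) measure set" where
  "couplings P Q =
    {J. sets J = sets (P \<Otimes>\<^sub>M Q) \<and> distr J P fst = P \<and> distr J Q snd = Q}"

definition W1 :: "'z::euclidean_space measure \<Rightarrow> 'z measure \<Rightarrow> ennreal" where
  "W1 P Q = (INF J\<in>couplings P Q. \<integral>\<^sup>+(z, z'). ennreal (l1_norm (z - z')) \<partial>J)"

text \<open>In particular \<open>clip c 0 = 0\<close>, since division by zero yields zero.\<close>

definition clip :: "real \<Rightarrow> 'a::real_normed_vector \<Rightarrow> 'a" where
  "clip c g = min 1 (c / norm g) *\<^sub>R g"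

definition isotropic_gaussian :: "real \<Rightarrow> 'a::euclidean_space measure" where
  "isotropic_gaussian \<sigma> =
    (if \<sigma> = 0 then return borel 0
     else density lborel (\<lambda>x. ennreal (\<Prod>b\<in>Basis. normal_density 0 \<sigma> (x \<bullet> b))))"

text \<open>
  The sigma-algebra generated by the samples and noise vectors with indices \<open>1, \<dots>, t\<close>
  (the trivial one for \<open>t = 0\<close>).
\<close>

definition past ::
  "'w measure \<Rightarrow> (nat \<Rightarrow> 'w \<Rightarrow> 'z::euclidean_space) \<Rightarrow> (nat \<Rightarrow> 'w \<Rightarrow> 'a::euclidean_space) \<Rightarrow> nat \<Rightarrow> 'w measure"
  where
  "past M Z \<zeta> t =
    vimage_algebra (space M) (\<lambda>\<omega>. \<lambda>s\<in>{1..t}. (Z s \<omega>, \<zeta> s \<omega>)) (\<Pi>\<^sub>M s\<in>{1..t}. borel \<Otimes>\<^sub>M borel)"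

text \<open>
  The second clause says that the conditional law of \<open>(Z (t + 1), \<zeta> (t + 1))\<close> given the past is the
  product of \<open>D (\<theta> t)\<close> and the Gaussian: the sample is drawn from the distribution induced by the
  current iterate, and the noise is independent of both the past and the sample.
\<close>

definition projected_clipped_sgd ::
  "'w measure \<Rightarrow> 'a::euclidean_space set \<Rightarrow> 'z::euclidean_space set \<Rightarrow> ('a \<Rightarrow> 'z \<Rightarrow> real) \<Rightarrow>
   ('a \<Rightarrow> 'z measure) \<Rightarrow> (nat \<Rightarrow> real) \<Rightarrow> real \<Rightarrow> real \<Rightarrow> 'a \<Rightarrow>
   (nat \<Rightarrow> 'w \<Rightarrow> 'z) \<Rightarrow> (nat \<Rightarrow> 'w \<Rightarrow> 'a) \<Rightarrow> (nat \<Rightarrow> 'w \<Rightarrow> 'a) \<Rightarrow> bool" where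
  "projected_clipped_sgd M X S loss D \<gamma> c \<sigma> \<theta>0 Z \<zeta> \<theta> \<longleftrightarrow>
    (\<forall>t. Z (t + 1) \<in> M \<rightarrow>\<^sub>M restrict_space borel S \<and> \<zeta> (t + 1) \<in> M \<rightarrow>\<^sub>M borel) \<and>
    (\<forall>t. \<forall>A\<in>sets (restrict_space borel S). \<forall>B\<in>sets borel.
      AE \<omega> in M.
        real_cond_exp M (past M Z \<zeta> t)
          (indicat_real {\<omega> \<in> space M. Z (t + 1) \<omega> \<in> A \<and> \<zeta> (t + 1) \<omega> \<in> B}) \<omega>
        = measure (D (\<theta> t \<omega>)) A * measure (isotropic_gaussian \<sigma>) B) \<and>
    (\<forall>\<omega>\<in>space M. \<theta> 0 \<omega> = \<theta>0) \<and>
    (\<forall>t. \<forall>\<omega>\<in>space M. \<theta> (t + 1) \<omega> =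
      closest_point X (\<theta> t \<omega> - \<gamma> (t + 1) *\<^sub>R
        (clip c (gradient (\<lambda>\<eta>. loss \<eta> (Z (t + 1) \<omega>)) (\<theta> t \<omega>)) + \<zeta> (t + 1) \<omega>)))"

end

theory Submission
  imports Defs
begin

text \<open>
  Write \<open>p\<close> for the performatively stable point, \<open>m = \<mu> - L \<beta>\<close> and \<open>B = max (G - c) 0\<close>. The
  argument is the usual one-step analysis of projected stochastic gradient descent; what has to be
  controlled in addition is that the sampling law moves with the iterate and that clipping biases
  the gradient.

  Fix \<open>x\<close> in \<open>X\<close>. Under the law \<open>D p\<close>, strong convexity of the risk together with minimality of
  \<open>p\<close> makes the expected gradient at \<open>x\<close> have inner product at least \<open>\<mu> \<parallel>x - p\<parallel>\<^sup>2\<close> with \<open>x - p\<close>.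
  The integrand is Lipschitz in the sample, so replacing \<open>D p\<close> by \<open>D x\<close> costs at most
  \<open>L \<parallel>x - p\<parallel> W1 (D x) (D p) \<le> L \<beta> \<parallel>x - p\<parallel>\<^sup>2\<close>, which leaves the margin \<open>m\<close>
  (\<open>expected_grad_monotone\<close>). Clipping moves a gradient of norm at most \<open>G\<close> by at most \<open>B\<close>. Since
  the noise is symmetric, it only adds its second moment, and with \<open>2 B u \<le> m u\<^sup>2 + B\<^sup>2 / m\<close> a step
  of size \<open>\<eta>\<close> from \<open>x\<close> has expected squared error at most
  \<open>(1 - m \<eta>) \<parallel>x - p\<parallel>\<^sup>2 + \<eta>\<^sup>2 (c\<^sup>2 + d \<sigma>\<^sup>2) + \<eta> B\<^sup>2 / m\<close> (\<open>one_step_bound\<close>).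

  This pointwise bound is carried over to the random iterate by disintegration: the joint law of
  the current iterate and the fresh pair of sample and noise is the law of the iterate followed by
  the kernel \<open>x \<mapsto> D x \<otimes> N(0, \<sigma>\<^sup>2 I)\<close>. That \<open>x \<mapsto> D x\<close> is a measurable kernel is a
  consequence of its Lipschitz continuity in \<open>W1\<close> (\<open>measurable_kernel_if_W1_Lipschitz\<close>).

  It remains to solve the recursion (\<open>clipped_recursion_bound\<close>). A step size up to \<open>2 / m\<close> may
  make the factor \<open>1 - m \<eta>\<close> negative, and then the recursion cannot be iterated. For such a step
  the claim holds for another reason: the margin and the gradient bound together force
  \<open>\<parallel>x - p\<parallel> \<le> G / m\<close> on all of \<open>X\<close>. So the error after the step and the modulus of the product
  term are each at most \<open>(G / m)\<^sup>2\<close>, and twice this amount is below the step-size term of the claimed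
  bound. This is where the summand \<open>2 G\<^sup>2\<close> in \<open>c1\<close> is used.
\<close>

section \<open>Clipping\<close>

lemma norm_clip_le:
  assumes "c > 0" shows "norm (clip c g) \<le> c"
  using assms by (cases "g = 0") (auto simp: clip_def min_def field_simps)

text \<open>
  This is the bias of clipping: a vector shorter than \<open>c\<close> is left alone, and a longer one is
  shortened by \<open>norm g - c\<close> along its own direction.
\<close>

lemma norm_clip_minus_le:
  assumes "c > 0" "norm g \<le> G" shows "norm (clip c g - g) \<le> max (G - c) 0"
proof (cases "norm g \<le> c")
  case True
  then have "clip c g = g"
    using assms by (cases "g = 0") (auto simp: clip_def min_def field_simps)
  then show ?thesis by simp
next
  case False
  then have g: "norm g > c" "g \<noteq> 0" using assms by auto
  have "clip c g - g = - ((1 - c / norm g) *\<^sub>R g)"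
    using g by (simp add: clip_def min_def scaleR_diff_left)
  then have "norm (clip c g - g) = \<bar>1 - c / norm g\<bar> * norm g"
    by simp
  also have "\<dots> = norm g - c" using g assms by (simp add: field_simps)
  finally show ?thesis using assms by simp
qed

lemma continuous_on_clip:
  fixes A :: "'a::real_normed_vector set"
  assumes "c > 0" shows "continuous_on A (clip c)"
proof -
  \<comment> \<open>Unlike the defining formula, this one has no quotient that is singular at the origin.\<close>
  have "clip c = (\<lambda>g::'a. (c / max c (norm g)) *\<^sub>R g)"
  proof
    fix g :: 'a
    show "clip c g = (c / max c (norm g)) *\<^sub>R g"
      using assms by (cases "g = 0"; cases "norm g \<le> c") (auto simp: clip_def min_def max_def field_simps)
  qed
  moreover have "max c (norm g) \<noteq> 0" for g :: 'a
    using assms by (auto simp: max_def)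
  ultimately show ?thesis by (auto intro!: continuous_intros)
qed

section \<open>Isotropic Gaussian noise\<close>

lemma sets_isotropic_gaussian [measurable_cong, simp]:
  "sets (isotropic_gaussian \<sigma>) = sets borel"
  by (simp add: isotropic_gaussian_def)

lemma space_isotropic_gaussian [simp]: "space (isotropic_gaussian \<sigma>) = UNIV"
  by (simp add: isotropic_gaussian_def)

lemma nn_integral_normal_density:
  assumes "\<sigma> > 0"
  shows "(\<integral>\<^sup>+x. ennreal (normal_density 0 \<sigma> x) \<partial>lborel) = 1"
    and "(\<integral>\<^sup>+x. ennreal (normal_density 0 \<sigma> x * x\<^sup>2) \<partial>lborel) = ennreal (\<sigma>\<^sup>2)"
proof -
  show "(\<integral>\<^sup>+x. ennreal (normal_density 0 \<sigma> x) \<partial>lborel) = 1"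
    using assms by (subst nn_integral_eq_integral) auto
  show "(\<integral>\<^sup>+x. ennreal (normal_density 0 \<sigma> x * x\<^sup>2) \<partial>lborel) = ennreal (\<sigma>\<^sup>2)"
    using assms integrable_normal_moment[OF assms, of 0 2] integral_normal_moment_even[OF assms, of 0 1]
    by (subst nn_integral_eq_integral) auto
qed

lemma nn_integral_isotropic_gaussian:
  fixes f :: "'a::euclidean_space \<Rightarrow> ennreal"
  assumes "\<sigma> > 0" and [measurable]: "f \<in> borel_measurable borel"
  shows "(\<integral>\<^sup>+y. f y \<partial>isotropic_gaussian \<sigma>) =
    (\<integral>\<^sup>+y. ennreal (\<Prod>b\<in>Basis. normal_density 0 \<sigma> (y \<bullet> b)) * f y \<partial>lborel)"
  using assms(1) by (simp add: isotropic_gaussian_def nn_integral_density)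

lemma prob_space_isotropic_gaussian:
  assumes "\<sigma> \<ge> 0" shows "prob_space (isotropic_gaussian \<sigma> :: 'a::euclidean_space measure)"
proof (cases "\<sigma> = 0")
  case True
  then show ?thesis by (simp add: isotropic_gaussian_def prob_space_return)
next
  case False
  then have s: "\<sigma> > 0" using assms by simp
  have "emeasure (isotropic_gaussian \<sigma> :: 'a measure) UNIV = (\<integral>\<^sup>+y. 1 \<partial>(isotropic_gaussian \<sigma> :: 'a measure))"
    by simp
  also have "\<dots> = (\<integral>\<^sup>+(y::'a). (\<Prod>b\<in>Basis. ennreal (normal_density 0 \<sigma> (y \<bullet> b))) \<partial>lborel)"
    by (subst nn_integral_isotropic_gaussian[OF s]) (auto simp: prod_ennreal)
  also have "\<dots> = 1"
    using s by (subst nn_integral_lborel_prod) (auto simp: nn_integral_normal_density)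
  finally show ?thesis by (intro prob_spaceI) simp
qed

lemma nn_integral_isotropic_gaussian_uminus:
  fixes f :: "'a::euclidean_space \<Rightarrow> ennreal"
  assumes "\<sigma> \<ge> 0" and [measurable]: "f \<in> borel_measurable borel"
  shows "(\<integral>\<^sup>+y. f (- y) \<partial>isotropic_gaussian \<sigma>) = (\<integral>\<^sup>+y. f y \<partial>isotropic_gaussian \<sigma>)"
proof (cases "\<sigma> = 0")
  case True
  then show ?thesis by (simp add: isotropic_gaussian_def nn_integral_return)
next
  case False
  then have s: "\<sigma> > 0" using assms by simp
  have n: "normal_density 0 \<sigma> (- x) = normal_density 0 \<sigma> x" for x
    by (simp add: normal_density_def)
  have u: "distr lborel borel uminus = (lborel :: 'a measure)"
    using lborel_affine[of "-1" "0 :: 'a"] by (simp add: density_1)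
  have "(\<integral>\<^sup>+y. f y \<partial>isotropic_gaussian \<sigma>) =
      (\<integral>\<^sup>+y. ennreal (\<Prod>b\<in>Basis. normal_density 0 \<sigma> (y \<bullet> b)) * f y \<partial>distr lborel borel uminus)"
    unfolding u by (rule nn_integral_isotropic_gaussian[OF s]) simp
  also have "\<dots> = (\<integral>\<^sup>+y. f (- y) \<partial>isotropic_gaussian \<sigma>)"
    by (subst nn_integral_distr) (auto simp: nn_integral_isotropic_gaussian[OF s] n)
  finally show ?thesis ..
qed

lemma nn_integral_isotropic_gaussian_norm_sq:
  assumes "\<sigma> \<ge> 0"
  shows "(\<integral>\<^sup>+y. ennreal ((norm y)\<^sup>2) \<partial>(isotropic_gaussian \<sigma> :: 'a::euclidean_space measure))
    = ennreal (real DIM('a) * \<sigma>\<^sup>2)"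
proof (cases "\<sigma> = 0")
  case True
  then show ?thesis by (simp add: isotropic_gaussian_def nn_integral_return)
next
  case False
  then have s: "\<sigma> > 0" using assms by simp
  let ?n = "normal_density 0 \<sigma>"
  have coord: "(\<integral>\<^sup>+y. ennreal ((y \<bullet> b)\<^sup>2) \<partial>isotropic_gaussian \<sigma>) = ennreal (\<sigma>\<^sup>2)"
    if b: "b \<in> Basis" for b :: 'a
  proof -
    \<comment> \<open>The weight \<open>(y \<bullet> b)\<^sup>2\<close> is absorbed into the factor with index \<open>b\<close>, so that the integral factorises.\<close>
    have "(\<integral>\<^sup>+y. ennreal ((y \<bullet> b)\<^sup>2) \<partial>isotropic_gaussian \<sigma>) =
        (\<integral>\<^sup>+y. (\<Prod>e\<in>Basis. ennreal (?n (y \<bullet> e) * (if e = b then (y \<bullet> e)\<^sup>2 else 1))) \<partial>lborel)"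
    proof (subst nn_integral_isotropic_gaussian[OF s])
      show "(\<integral>\<^sup>+y. ennreal (\<Prod>e\<in>Basis. ?n (y \<bullet> e)) * ennreal ((y \<bullet> b)\<^sup>2) \<partial>lborel) =
        (\<integral>\<^sup>+y. (\<Prod>e\<in>Basis. ennreal (?n (y \<bullet> e) * (if e = b then (y \<bullet> e)\<^sup>2 else 1))) \<partial>lborel)"
        using b by (intro nn_integral_cong)
          (simp add: prod_ennreal ennreal_mult[symmetric] prod_nonneg prod.distrib)
    qed auto
    also have "\<dots> = (\<Prod>e\<in>Basis. \<integral>\<^sup>+x. ennreal (?n x * (if e = b then x\<^sup>2 else 1)) \<partial>lborel)"
      by (rule nn_integral_lborel_prod) auto
    also have "\<dots> = (\<Prod>e\<in>Basis. if e = b then ennreal (\<sigma>\<^sup>2) else 1)"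
      using nn_integral_normal_density[OF s] by (intro prod.cong) auto
    also have "\<dots> = ennreal (\<sigma>\<^sup>2)" using b by simp
    finally show ?thesis .
  qed
  have "(\<integral>\<^sup>+y. ennreal ((norm y)\<^sup>2) \<partial>(isotropic_gaussian \<sigma> :: 'a measure)) =
      (\<integral>\<^sup>+y. (\<Sum>b\<in>Basis. ennreal ((y \<bullet> b)\<^sup>2)) \<partial>(isotropic_gaussian \<sigma> :: 'a measure))"
  proof (rule nn_integral_cong)
    fix y :: 'a
    have "(norm y)\<^sup>2 = (\<Sum>b\<in>Basis. (y \<bullet> b)\<^sup>2)"
      unfolding power2_norm_eq_inner unfolding power2_eq_square by (rule euclidean_inner)
    then show "ennreal ((norm y)\<^sup>2) = (\<Sum>b\<in>Basis. ennreal ((y \<bullet> b)\<^sup>2))"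
      by (simp add: sum_ennreal)
  qed
  also have "\<dots> = (\<Sum>b\<in>(Basis :: 'a set). ennreal (\<sigma>\<^sup>2))"
    by (subst nn_integral_sum) (auto simp: coord)
  finally show ?thesis by (simp add: ennreal_mult ennreal_of_nat_eq_real_of_nat)
qed

text \<open>
  Symmetry of the noise replaces the argument that the cross term has mean zero: averaging the
  integrand over \<open>y\<close> and \<open>- y\<close> gives \<open>(norm w)\<^sup>2 + a\<^sup>2 * (norm y)\<^sup>2\<close> by the parallelogram law. In
  this form everything stays in the extended nonnegative reals, without integrability conditions.
\<close>

lemma nn_integral_isotropic_gaussian_shift:
  fixes w :: "'a::euclidean_space"
  assumes "\<sigma> \<ge> 0"
  shows "(\<integral>\<^sup>+y. ennreal ((norm (w + a *\<^sub>R y))\<^sup>2) \<partial>isotropic_gaussian \<sigma>)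
    = ennreal ((norm w)\<^sup>2 + a\<^sup>2 * (real DIM('a) * \<sigma>\<^sup>2))" (is "?I = _")
proof -
  interpret prob_space "isotropic_gaussian \<sigma> :: 'a measure"
    by (rule prob_space_isotropic_gaussian[OF assms])
  have collect: "ennreal u + ennreal v * ennreal r = ennreal (u + v * r)"
    if "u \<ge> 0" "v \<ge> 0" "r \<ge> 0" for u v r
    using that by (simp add: ennreal_mult)
  have "2 * ?I = ?I + (\<integral>\<^sup>+y. ennreal ((norm (w + a *\<^sub>R (- y)))\<^sup>2) \<partial>isotropic_gaussian \<sigma>)"
    using nn_integral_isotropic_gaussian_uminus[OF assms, of "\<lambda>y. ennreal ((norm (w + a *\<^sub>R y))\<^sup>2)"]
    by (simp add: mult_2)
  also have "\<dots> = (\<integral>\<^sup>+y. ennreal ((norm (w + a *\<^sub>R y))\<^sup>2) + ennreal ((norm (w + a *\<^sub>R (- y)))\<^sup>2)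
      \<partial>isotropic_gaussian \<sigma>)"
    by (subst nn_integral_add) auto
  also have "\<dots> = (\<integral>\<^sup>+(y::'a). ennreal (2 * (norm w)\<^sup>2) + ennreal (2 * a\<^sup>2) * ennreal ((norm y)\<^sup>2)
      \<partial>isotropic_gaussian \<sigma>)"
  proof (rule nn_integral_cong)
    fix y :: 'a
    have "(norm (w + a *\<^sub>R y))\<^sup>2 + (norm (w + a *\<^sub>R (- y)))\<^sup>2 = 2 * (norm w)\<^sup>2 + 2 * a\<^sup>2 * (norm y)\<^sup>2"
      unfolding power2_norm_eq_inner
      by (simp add: inner_add_left inner_add_right inner_diff_left inner_diff_right power2_eq_square
        algebra_simps)
    then show "ennreal ((norm (w + a *\<^sub>R y))\<^sup>2) + ennreal ((norm (w + a *\<^sub>R (- y)))\<^sup>2) =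
        ennreal (2 * (norm w)\<^sup>2) + ennreal (2 * a\<^sup>2) * ennreal ((norm y)\<^sup>2)"
      by (simp add: collect del: ennreal_plus) (simp add: ennreal_plus[symmetric] del: ennreal_plus)
  qed
  also have "\<dots> = ennreal (2 * (norm w)\<^sup>2) + ennreal (2 * a\<^sup>2) * ennreal (real DIM('a) * \<sigma>\<^sup>2)"
    by (subst nn_integral_add)
      (auto simp: nn_integral_cmult nn_integral_isotropic_gaussian_norm_sq[OF assms]
        emeasure_space_1[simplified])
  also have "\<dots> = 2 * ennreal ((norm w)\<^sup>2 + a\<^sup>2 * (real DIM('a) * \<sigma>\<^sup>2))"
    using collect[of "2 * (norm w)\<^sup>2" "2 * a\<^sup>2" "real DIM('a) * \<sigma>\<^sup>2"]
      ennreal_mult'[of 2 "(norm w)\<^sup>2 + a\<^sup>2 * (real DIM('a) * \<sigma>\<^sup>2)"]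
    by (simp add: algebra_simps)
  finally show ?thesis unfolding ennreal_mult_cancel_left by simp
qed

section \<open>Wasserstein distance and kernels\<close>

lemma norm_le_l1_norm: "norm z \<le> l1_norm z"
  unfolding l1_norm_def by (rule norm_le_l1)

lemma borel_measurable_l1_norm [measurable]: "l1_norm \<in> borel_measurable borel"
  unfolding l1_norm_def by measurable

text \<open>
  The elementary half of Kantorovich duality: under any coupling the difference of the two integrals
  is the expectation of \<open>h z - h z'\<close>, hence at most \<open>K\<close> times the transport cost. The Lipschitz
  condition is in the Euclidean norm, which the \<open>\<ell>\<^sub>1\<close> cost dominates.
\<close>

lemma integral_diff_le_W1:
  fixes h :: "'z::euclidean_space \<Rightarrow> real"
  assumes P: "prob_space P" "sets P = sets (restrict_space borel S)"
    and Q: "prob_space Q" "sets Q = sets (restrict_space borel S)"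
    and K: "K \<ge> 0" and lip: "\<And>z z'. z \<in> S \<Longrightarrow> z' \<in> S \<Longrightarrow> \<bar>h z - h z'\<bar> \<le> K * norm (z - z')"
    and bdd: "\<And>z. z \<in> S \<Longrightarrow> \<bar>h z\<bar> \<le> b"
    and W: "W1 P Q \<le> ennreal r" and r: "r \<ge> 0"
  shows "\<bar>(\<integral>z. h z \<partial>P) - (\<integral>z. h z \<partial>Q)\<bar> \<le> K * r"
proof (rule field_le_epsilon)
  fix e :: real assume e: "e > 0"
  \<comment> \<open>The infimum in \<open>W1\<close> need not be attained, so a coupling within \<open>e'\<close> of it is used; dividing by \<open>K + 1\<close> also covers \<open>K = 0\<close>.\<close>
  define e' where "e' = e / (K + 1)"
  have e': "e' > 0" "K * e' \<le> e" using e K by (auto simp: e'_def field_simps)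
  have "W1 P Q < ennreal (r + e')"
    using W e' r by (meson ennreal_lessI le_less_trans less_add_same_cancel1 add_pos_nonneg order_less_le_trans add_nonneg_pos)
  then obtain J where J: "J \<in> couplings P Q"
    and Jr: "(\<integral>\<^sup>+(z, z'). ennreal (l1_norm (z - z')) \<partial>J) < ennreal (r + e')"
    unfolding W1_def INF_less_iff by blast
  note P(2)[measurable_cong] Q(2)[measurable_cong]
  have sP: "space P = S" "space Q = S"
    using sets_eq_imp_space_eq[OF P(2)] sets_eq_imp_space_eq[OF Q(2)] by (auto simp: space_restrict_space)
  have sJ[measurable_cong]: "sets J = sets (P \<Otimes>\<^sub>M Q)" and m: "distr J P fst = P" "distr J Q snd = Q"
    using J by (auto simp: couplings_def)
  have spJ: "space J = S \<times> S" using sets_eq_imp_space_eq[OF sJ] sP by (simp add: space_pair_measure)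
  have f[measurable]: "fst \<in> measurable J P" "snd \<in> measurable J Q" by measurable
  have id: "id \<in> measurable (restrict_space borel S) borel" by (simp add: measurable_restrict_space1)
  have f'[measurable]: "fst \<in> measurable J borel" "snd \<in> measurable J borel"
    using measurable_compose[OF f(1), of id borel] measurable_compose[OF f(2), of id borel] id
    by (auto simp: measurable_cong_sets[OF P(2) refl] measurable_cong_sets[OF Q(2) refl])
  interpret P: prob_space P by fact
  interpret J: prob_space J
  proof (rule prob_spaceI)
    have "fst -` space P \<inter> space J = space J" by (auto simp: spJ sP)
    then have "emeasure J (space J) = emeasure (distr J P fst) (space P)"
      using emeasure_distr[OF f(1) sets.top] by simp
    then show "emeasure J (space J) = 1" by (simp add: m P.emeasure_space_1)
  qed
  have "continuous_on S h"
    by (rule lipschitz_on_continuous_on[of K])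
      (auto intro!: lipschitz_onI K lip simp: dist_norm)
  then have h: "h \<in> borel_measurable (restrict_space borel S)"
    by (rule borel_measurable_continuous_on_restrict)
  have [measurable]: "h \<in> borel_measurable P" "h \<in> borel_measurable Q"
    using h by (auto simp: measurable_cong_sets[OF P(2) refl] measurable_cong_sets[OF Q(2) refl])
  have i: "integrable J (\<lambda>w. h (fst w))" "integrable J (\<lambda>w. h (snd w))"
    by (auto intro!: J.integrable_const_bound[of _ b] AE_I2 bdd simp: spJ)
  have "(\<integral>z. h z \<partial>P) = (\<integral>w. h (fst w) \<partial>J)"
    by (subst m(1)[symmetric]) (simp add: integral_distr)
  moreover have "(\<integral>z. h z \<partial>Q) = (\<integral>w. h (snd w) \<partial>J)"
    by (subst m(2)[symmetric]) (simp add: integral_distr)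
  ultimately have eq: "(\<integral>z. h z \<partial>P) - (\<integral>z. h z \<partial>Q) = (\<integral>w. h (fst w) - h (snd w) \<partial>J)"
    using i by simp
  have "ennreal \<bar>\<integral>w. h (fst w) - h (snd w) \<partial>J\<bar> \<le> (\<integral>\<^sup>+w. ennreal \<bar>h (fst w) - h (snd w)\<bar> \<partial>J)"
    using integral_norm_bound_ennreal[of J "\<lambda>w. h (fst w) - h (snd w)"] i by simp
  also have "\<dots> \<le> (\<integral>\<^sup>+w. ennreal K * ennreal (l1_norm (fst w - snd w)) \<partial>J)"
  proof (intro nn_integral_mono)
    fix w assume "w \<in> space J"
    then have "\<bar>h (fst w) - h (snd w)\<bar> \<le> K * norm (fst w - snd w)"
      by (intro lip) (auto simp: spJ)
    also have "\<dots> \<le> K * l1_norm (fst w - snd w)"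
      by (intro mult_left_mono norm_le_l1_norm K)
    finally show "ennreal \<bar>h (fst w) - h (snd w)\<bar> \<le> ennreal K * ennreal (l1_norm (fst w - snd w))"
      using K by (simp add: ennreal_mult'[symmetric] ennreal_leI)
  qed
  also have "\<dots> = ennreal K * (\<integral>\<^sup>+(z, z'). ennreal (l1_norm (z - z')) \<partial>J)"
    by (subst nn_integral_cmult) (auto simp: case_prod_beta')
  also have "\<dots> \<le> ennreal K * ennreal (r + e')"
    using Jr by (intro mult_left_mono) auto
  also have "\<dots> = ennreal (K * (r + e'))"
    using K by (simp add: ennreal_mult')
  finally have "\<bar>\<integral>w. h (fst w) - h (snd w) \<partial>J\<bar> \<le> K * (r + e')"
    using K r e' by (subst (asm) ennreal_le_iff) auto
  then show "\<bar>(\<integral>z. h z \<partial>P) - (\<integral>z. h z \<partial>Q)\<bar> \<le> K * r + e"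
    using e' unfolding eq by (simp add: algebra_simps)
qed

text \<open>
  Lipschitz continuity in \<open>W1\<close> makes \<open>x \<mapsto> \<integral> h d(D x)\<close> continuous for every bounded Lipschitz
  function \<open>h\<close>. Indicators of closed sets are pointwise limits of such functions, so the measure of
  each closed set depends measurably on \<open>x\<close>; closed sets are stable under intersection and generate
  the Borel sets.
\<close>

lemma measurable_kernel_if_W1_Lipschitz:
  fixes D :: "'a::euclidean_space \<Rightarrow> 'z::euclidean_space measure"
  assumes D: "\<And>x. x \<in> X \<Longrightarrow> prob_space (D x)"
    "\<And>x. x \<in> X \<Longrightarrow> sets (D x) = sets (restrict_space borel S)"
    and \<beta>: "\<beta> \<ge> 0"
    and W: "\<And>x y. x \<in> X \<Longrightarrow> y \<in> X \<Longrightarrow> W1 (D x) (D y) \<le> ennreal (\<beta> * norm (x - y))"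
  shows "D \<in> restrict_space borel X \<rightarrow>\<^sub>M prob_algebra (restrict_space borel S)"
proof (rule measurable_prob_algebra_generated)
  let ?G = "(\<lambda>C. C \<inter> S) ` Collect closed"
  show "sets (restrict_space borel S) = sigma_sets S ?G"
  proof -
    have "sets (restrict_space borel S) = {(\<lambda>z. z) -` A \<inter> S |A. A \<in> sigma_sets UNIV (Collect closed)}"
      unfolding sets_restrict_space by (subst borel_eq_closed, subst sets_measure_of) auto
    also have "\<dots> = sigma_sets S {(\<lambda>z. z) -` A \<inter> S |A. A \<in> Collect closed}"
      by (rule sigma_sets_vimage_commute) auto
    also have "{(\<lambda>z. z) -` A \<inter> S |A. A \<in> Collect closed} = ?G" by auto
    finally show ?thesis .
  qed
  show "Int_stable ?G"
  proof (rule Int_stableI)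
    fix a b assume "a \<in> ?G" "b \<in> ?G"
    then obtain A B where "closed A" "closed B" "a = A \<inter> S" "b = B \<inter> S" by auto
    then have "a \<inter> b = (A \<inter> B) \<inter> S" "closed (A \<inter> B)" by auto
    then show "a \<inter> b \<in> ?G" by blast
  qed
  show "?G \<subseteq> Pow S" by auto
  show "prob_space (D a)" if "a \<in> space (restrict_space borel X)" for a
    using that D by (simp add: space_restrict_space)
  show "sets (D a) = sets (restrict_space borel S)" if "a \<in> space (restrict_space borel X)" for a
    using that D by (simp add: space_restrict_space)
  fix A assume "A \<in> ?G"
  then obtain C where C: "closed C" "A = C \<inter> S" by auto
  show "(\<lambda>x. emeasure (D x) A) \<in> borel_measurable (restrict_space borel X)"
  proof (cases "C = {}")
    case True
    then show ?thesis using C by simp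
  next
    case False
    define h where "h n z = max 0 (1 - real n * infdist z C)" for n z
    have h01: "0 \<le> h n z" "h n z \<le> 1" for n z by (auto simp: h_def infdist_nonneg)
    have hlip: "\<bar>h n z - h n z'\<bar> \<le> real n * norm (z - z')" for n z z'
    proof -
      have "\<bar>h n z - h n z'\<bar> \<le> \<bar>real n * infdist z C - real n * infdist z' C\<bar>"
        unfolding h_def by linarith
      also have "\<dots> = real n * \<bar>infdist z C - infdist z' C\<bar>"
        by (simp add: abs_mult flip: right_diff_distrib)
      also have "\<dots> \<le> real n * norm (z - z')"
        using infdist_triangle_abs[of z C z'] by (intro mult_left_mono) (auto simp: dist_norm)
      finally show ?thesis .
    qed
    have lim: "(\<lambda>n. h n z) \<longlonglongrightarrow> indicat_real C z" for z
    proof (cases "z \<in> C")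
      case True
      then show ?thesis by (simp add: h_def)
    next
      case zC: False
      then have p: "infdist z C > 0"
        using C False infdist_pos_not_in_closed by blast
      have "eventually (\<lambda>n. 1 / infdist z C \<le> real n) sequentially"
        by real_asymp
      then have "eventually (\<lambda>n. h n z = 0) sequentially"
        by eventually_elim (use p in \<open>auto simp: h_def field_simps max_def\<close>)
      then show ?thesis using zC by (auto intro: tendsto_eventually)
    qed
    have int: "(\<lambda>x. \<integral>z. h n z \<partial>D x) \<in> borel_measurable (restrict_space borel X)" for n
    proof (rule borel_measurable_continuous_on_restrict, rule lipschitz_on_continuous_on)
      show "(real n * \<beta>)-lipschitz_on X (\<lambda>x. \<integral>z. h n z \<partial>D x)"
      proof (rule lipschitz_onI)
        fix x y assume xy: "x \<in> X" "y \<in> X"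
        have "\<bar>(\<integral>z. h n z \<partial>D x) - (\<integral>z. h n z \<partial>D y)\<bar> \<le> real n * (\<beta> * norm (x - y))"
          using xy h01 \<beta> by (intro integral_diff_le_W1[where S=S and b=1] D W hlip) auto
        then show "dist (\<integral>z. h n z \<partial>D x) (\<integral>z. h n z \<partial>D y) \<le> real n * \<beta> * dist x y"
          by (simp add: dist_norm mult.assoc)
      qed (use \<beta> in auto)
    qed
    have "(\<lambda>x. measure (D x) A) \<in> borel_measurable (restrict_space borel X)"
    proof (rule borel_measurable_LIMSEQ_real[OF _ int])
      fix x assume "x \<in> space (restrict_space borel X)"
      then have x: "x \<in> X" by (simp add: space_restrict_space)
      interpret prob_space "D x" by (rule D(1)[OF x])
      have sp: "space (D x) = S"
        using sets_eq_imp_space_eq[OF D(2)[OF x]] by (simp add: space_restrict_space)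
      have "continuous_on S (h n)" for n
        by (rule lipschitz_on_continuous_on[of "real n"]) (auto intro!: lipschitz_onI hlip simp: dist_norm)
      then have [measurable]: "h n \<in> borel_measurable (D x)" for n
        by (subst measurable_cong_sets[OF D(2)[OF x] refl])
           (rule borel_measurable_continuous_on_restrict)
      have [measurable]: "A \<in> sets (D x)"
        using C by (auto simp: D(2)[OF x] sets_restrict_space)
      have "(\<lambda>n. \<integral>z. h n z \<partial>D x) \<longlonglongrightarrow> (\<integral>z. indicat_real A z \<partial>D x)"
      proof (rule integral_dominated_convergence[where w="\<lambda>_. 1"])
        show "AE z in D x. (\<lambda>n. h n z) \<longlonglongrightarrow> indicat_real A z"
          using lim by (intro AE_I2) (auto simp: C sp indicator_def)
      qed (use h01 in auto)
      then show "(\<lambda>n. \<integral>z. h n z \<partial>D x) \<longlonglongrightarrow> measure (D x) A" by simp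
    qed
    then have "(\<lambda>x. ennreal (measure (D x) A)) \<in> borel_measurable (restrict_space borel X)"
      by measurable
    then show ?thesis
      by (rule measurable_cong[THEN iffD1, rotated])
        (auto simp: space_restrict_space D prob_space.finite_measure finite_measure.emeasure_eq_measure)
  qed
qed

section \<open>Differentiating the expected loss\<close>

lemma has_derivative_gradient:
  fixes h :: "'a::euclidean_space \<Rightarrow> real"
  assumes "h differentiable (at x)"
  shows "(h has_derivative (\<lambda>v. gradient h x \<bullet> v)) (at x)"
proof -
  obtain h' where h': "(h has_derivative h') (at x)"
    using assms by (auto simp: differentiable_def)
  interpret bounded_linear h' by (rule has_derivative_bounded_linear[OF h'])
  define w where "w = (\<Sum>b\<in>Basis. h' b *\<^sub>R b)"
  have "h' = (\<lambda>v. v \<bullet> w)"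
  proof
    fix v
    have "h' v = h' (\<Sum>b\<in>Basis. (v \<bullet> b) *\<^sub>R b)" by (simp add: euclidean_representation)
    also have "\<dots> = (\<Sum>b\<in>Basis. (v \<bullet> b) * h' b)" by (simp add: sum scaleR)
    also have "\<dots> = v \<bullet> w" by (simp add: w_def inner_sum_right mult.commute)
    finally show "h' v = v \<bullet> w" .
  qed
  then have w: "GDERIV h x :> w" using h' by (simp add: gderiv_def)
  moreover have "w' = w" if "GDERIV h x :> w'" for w'
  proof -
    have "(\<lambda>v. v \<bullet> w') = (\<lambda>v. v \<bullet> w)"
      using that w unfolding gderiv_def by (rule has_derivative_unique)
    then have "\<forall>v. v \<bullet> w' = v \<bullet> w" by (simp add: fun_eq_iff)
    then show ?thesis by (simp only: vector_eq_ldot)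
  qed
  ultimately have "gradient h x = w" unfolding gradient_def by (rule the_equality)
  then show ?thesis using w by (simp add: gderiv_def inner_commute)
qed

text \<open>
  A derivative relative to a convex set determines the slopes along segments inside the set. They
  are stated along a sequence so that dominated convergence applies to them.
\<close>

lemma difference_quotient_tendsto:
  fixes F :: "'a::euclidean_space \<Rightarrow> real"
  assumes F: "(F has_derivative (\<lambda>h. v \<bullet> h)) (at x within X)"
    and X: "convex X" "x \<in> X" "y \<in> X"
  shows "(\<lambda>n. (F (x + inverse (real (Suc n)) *\<^sub>R (y - x)) - F x) / inverse (real (Suc n)))
    \<longlonglongrightarrow> v \<bullet> (y - x)"
proof -
  let ?p = "\<lambda>s::real. x + s *\<^sub>R (y - x)"
  have sub: "?p ` {0..1} \<subseteq> X"
  proof (clarify)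
    fix s :: real assume "s \<in> {0..1}"
    then have "(1 - s) *\<^sub>R x + s *\<^sub>R y \<in> X" using X by (intro convexD) auto
    then show "?p s \<in> X" by (simp add: algebra_simps)
  qed
  have "(?p has_derivative (\<lambda>s. s *\<^sub>R (y - x))) (at 0 within {0..1})"
    by (auto intro!: derivative_eq_intros)
  moreover have "(F has_derivative (\<lambda>h. v \<bullet> h)) (at (?p 0) within ?p ` {0..1})"
    using has_derivative_subset[OF F sub] by simp
  ultimately have "(F \<circ> ?p has_derivative (\<lambda>h. v \<bullet> h) \<circ> (\<lambda>s. s *\<^sub>R (y - x))) (at 0 within {0..1})"
    by (rule diff_chain_within)
  then have "((\<lambda>s. F (?p s)) has_field_derivative v \<bullet> (y - x)) (at 0 within {0..1})"
    unfolding has_field_derivative_def by (simp add: o_def mult_commute_abs)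
  then have lim: "((\<lambda>s. (F (?p s) - F x) / s) \<longlongrightarrow> v \<bullet> (y - x)) (at 0 within {0..1})"
    by (simp add: has_field_derivative_iff)
  have "filterlim (\<lambda>n. inverse (real (Suc n))) (at 0 within {0..1}) sequentially"
    unfolding filterlim_at using LIMSEQ_inverse_real_of_nat by (auto simp: field_simps)
  from filterlim_compose[OF lim this] show ?thesis .
qed

text \<open>
  Differentiation under the integral sign, in the directions that stay inside \<open>X\<close>. The mean value
  bound by \<open>G\<close> dominates the difference quotients. Only these directions matter, which is why a
  derivative \<open>v\<close> relative to \<open>X\<close>, possibly not unique, can be treated like the expected gradient.
\<close>

lemma inner_derivative_expected_loss:
  fixes loss :: "'a::euclidean_space \<Rightarrow> 'z \<Rightarrow> real"
  assumes P: "prob_space P" and X: "convex X" "x \<in> X" "y \<in> X"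
    and diff: "\<And>x z. x \<in> X \<Longrightarrow> z \<in> space P \<Longrightarrow> (\<lambda>u. loss u z) differentiable (at x)"
    and int: "\<And>x. x \<in> X \<Longrightarrow> integrable P (loss x)"
    and G: "\<And>x z. x \<in> X \<Longrightarrow> z \<in> space P \<Longrightarrow> norm (gradient (\<lambda>u. loss u z) x) \<le> G"
    and v: "((\<lambda>u. \<integral>z. loss u z \<partial>P) has_derivative (\<lambda>h. v \<bullet> h)) (at x within X)"
  shows "v \<bullet> (y - x) = (\<integral>z. gradient (\<lambda>u. loss u z) x \<bullet> (y - x) \<partial>P)"
proof -
  interpret prob_space P by fact
  define s where "s n = inverse (real (Suc n))" for n
  define p where "p n = x + s n *\<^sub>R (y - x)" for n
  define q where "q n z = (loss (p n) z - loss x z) / s n" for n z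
  have s: "0 < s n" "s n \<le> 1" for n by (auto simp: s_def field_simps)
  have p: "p n \<in> X" for n
  proof -
    have "(1 - s n) *\<^sub>R x + s n *\<^sub>R y \<in> X" using X s[of n] by (intro convexD) auto
    then show ?thesis by (simp add: algebra_simps p_def)
  qed
  have int_q: "integrable P (q n)" for n
    unfolding q_def by (intro integrable_divide Bochner_Integration.integrable_diff int p X)
  have q_lim: "(\<lambda>n. q n z) \<longlonglongrightarrow> gradient (\<lambda>u. loss u z) x \<bullet> (y - x)" if "z \<in> space P" for z
    unfolding q_def p_def s_def
    by (rule difference_quotient_tendsto[OF _ X])
      (rule has_derivative_at_withinI[OF has_derivative_gradient[OF diff[OF X(2) that]]])
  have q_bound: "\<bar>q n z\<bar> \<le> G * norm (y - x)" if z: "z \<in> space P" for n z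
  proof -
    have "norm (loss (p n) z - loss x z) \<le> G * norm (p n - x)"
    proof (rule differentiable_bound[OF X(1)])
      fix u assume u: "u \<in> X"
      show "((\<lambda>u. loss u z) has_derivative (\<lambda>h. gradient (\<lambda>u. loss u z) u \<bullet> h)) (at u within X)"
        by (rule has_derivative_at_withinI[OF has_derivative_gradient[OF diff[OF u z]]])
      show "onorm (\<lambda>h. gradient (\<lambda>u. loss u z) u \<bullet> h) \<le> G"
      proof (rule onorm_le)
        fix h
        show "norm (gradient (\<lambda>u. loss u z) u \<bullet> h) \<le> G * norm h"
          using order_trans[OF Cauchy_Schwarz_ineq2 mult_right_mono[OF G[OF u z] norm_ge_zero]]
          by simp
      qed
    qed (use p X in auto)
    also have "norm (p n - x) = s n * norm (y - x)" using s[of n] by (simp add: p_def)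
    finally show ?thesis using s[of n] by (simp add: q_def abs_divide field_simps)
  qed
  have g_meas: "(\<lambda>z. gradient (\<lambda>u. loss u z) x \<bullet> (y - x)) \<in> borel_measurable P"
    by (rule borel_measurable_LIMSEQ_real[OF q_lim]) (use int_q in auto)
  have "(\<lambda>n. \<integral>z. q n z \<partial>P) \<longlonglongrightarrow> (\<integral>z. gradient (\<lambda>u. loss u z) x \<bullet> (y - x) \<partial>P)"
    by (rule integral_dominated_convergence[where w="\<lambda>_. G * norm (y - x)"])
      (use g_meas int_q q_lim q_bound in auto)
  moreover have "(\<integral>z. q n z \<partial>P) = ((\<integral>z. loss (p n) z \<partial>P) - (\<integral>z. loss x z \<partial>P)) / s n" for n
    using int[OF p[of n]] int[OF X(2)] by (simp add: q_def)
  ultimately have "(\<lambda>n. ((\<integral>z. loss (p n) z \<partial>P) - (\<integral>z. loss x z \<partial>P)) / s n) \<longlonglongrightarrow>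
      (\<integral>z. gradient (\<lambda>u. loss u z) x \<bullet> (y - x) \<partial>P)" by simp
  then show ?thesis
    using difference_quotient_tendsto[OF v X] unfolding p_def s_def
    by (rule LIMSEQ_unique[rotated])
qed

section \<open>Disintegration of joint laws\<close>

text \<open>
  If \<open>K\<close> gives the conditional law of \<open>V\<close> given \<open>Y\<close> on rectangles whose second side is taken from
  an intersection-stable generator, then it does so for every nonnegative function of the pair: both
  sides are integrals against finite measures on the product space that agree on a generator.
\<close>

lemma nn_integral_disintegration:
  fixes h :: "'b \<times> 'c \<Rightarrow> ennreal"
  assumes M: "prob_space M"
    and Y[measurable]: "Y \<in> M \<rightarrow>\<^sub>M N1" and V[measurable]: "V \<in> M \<rightarrow>\<^sub>M N2"
    and K: "K \<in> N1 \<rightarrow>\<^sub>M prob_algebra N2"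
    and E: "sets N2 = sigma_sets (space N2) E" "Int_stable E" "E \<subseteq> Pow (space N2)" "space N2 \<in> E"
    and rect: "\<And>A B. A \<in> sets N1 \<Longrightarrow> B \<in> E \<Longrightarrow>
      emeasure M {\<omega> \<in> space M. Y \<omega> \<in> A \<and> V \<omega> \<in> B} =
      (\<integral>\<^sup>+\<omega>. indicator A (Y \<omega>) * emeasure (K (Y \<omega>)) B \<partial>M)"
    and h[measurable]: "h \<in> borel_measurable (N1 \<Otimes>\<^sub>M N2)"
  shows "(\<integral>\<^sup>+\<omega>. h (Y \<omega>, V \<omega>) \<partial>M) = (\<integral>\<^sup>+\<omega>. \<integral>\<^sup>+v. h (Y \<omega>, v) \<partial>K (Y \<omega>) \<partial>M)"
proof -
  interpret prob_space M by fact
  let ?N = "N1 \<Otimes>\<^sub>M N2"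
  define k where "k x = distr (K x) ?N (Pair x)" for x
  note K' = measurable_prob_algebraD[OF K]
  have k: "k \<in> N1 \<rightarrow>\<^sub>M subprob_algebra ?N"
    unfolding k_def by (rule measurable_distr2[OF _ K']) simp
  have sK: "sets (K x) = sets N2" if "x \<in> space N1" for x
    using measurable_space[OF K that] by (simp add: space_prob_algebra)
  have pair: "Pair x \<in> K x \<rightarrow>\<^sub>M ?N" if "x \<in> space N1" for x
    using that by (simp add: measurable_cong_sets[OF sK[OF that] refl])
  have Ysp: "Y \<omega> \<in> space N1" if "\<omega> \<in> space M" for \<omega>
    using measurable_space[OF Y that] .
  \<comment> \<open>\<open>J\<close> is the joint law of \<open>Y\<close> and \<open>V\<close>, and \<open>J'\<close> is what the kernel predicts for it.\<close>
  define J where "J = distr M ?N (\<lambda>\<omega>. (Y \<omega>, V \<omega>))"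
  define J' where "J' = distr M N1 Y \<bind> k"
  have kd: "k \<in> distr M N1 Y \<rightarrow>\<^sub>M subprob_algebra ?N" using k by simp
  have nn: "(\<integral>\<^sup>+w. f w \<partial>J') = (\<integral>\<^sup>+\<omega>. \<integral>\<^sup>+v. f (Y \<omega>, v) \<partial>K (Y \<omega>) \<partial>M)"
    if f[measurable]: "f \<in> borel_measurable ?N" for f
  proof -
    have "(\<integral>\<^sup>+w. f w \<partial>J') = (\<integral>\<^sup>+x. \<integral>\<^sup>+w. f w \<partial>k x \<partial>distr M N1 Y)"
      unfolding J'_def by (rule nn_integral_bind[OF f kd])
    also have "\<dots> = (\<integral>\<^sup>+\<omega>. \<integral>\<^sup>+w. f w \<partial>k (Y \<omega>) \<partial>M)"
      by (rule nn_integral_distr[OF Y]) (simp, rule nn_integral_measurable_subprob_algebra2[OF _ k], simp)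
    also have "\<dots> = (\<integral>\<^sup>+\<omega>. \<integral>\<^sup>+v. f (Y \<omega>, v) \<partial>K (Y \<omega>) \<partial>M)"
      unfolding k_def
    proof (rule nn_integral_cong)
      fix \<omega> assume "\<omega> \<in> space M"
      from pair[OF Ysp[OF this]]
      show "(\<integral>\<^sup>+w. f w \<partial>distr (K (Y \<omega>)) ?N (Pair (Y \<omega>))) = (\<integral>\<^sup>+v. f (Y \<omega>, v) \<partial>K (Y \<omega>))"
        by (rule nn_integral_distr) simp
    qed
    finally show ?thesis .
  qed
  have ne: "space (distr M N1 Y) \<noteq> {}" using not_empty Ysp by auto
  have sJ': "sets J' = sets ?N" unfolding J'_def by (rule sets_bind[OF sets_kernel[OF kd] ne])
  let ?E = "{A \<times> B |A B. A \<in> sets N1 \<and> B \<in> E}"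
  have E_sub: "?E \<subseteq> Pow (space N1 \<times> space N2)"
    using E(3) sets.sets_into_space[of _ N1] by blast
  have gen: "sets ?N = sigma_sets (space N1 \<times> space N2) ?E"
    by (subst sets_pair_eq[where Ea="sets N1" and Eb=E and Ca="{space N1}" and Cb="{space N2}"])
      (use E sets.space_closed[of N1] sets_measure_of[OF E_sub] in \<open>auto simp: sets.sigma_sets_eq\<close>)
  have "J = J'"
  proof (rule measure_eqI_generator_eq[where E="?E" and \<Omega>="space N1 \<times> space N2"
        and A="\<lambda>_. space N1 \<times> space N2"])
    show "Int_stable ?E"
    proof (rule Int_stableI)
      fix a b assume "a \<in> ?E" "b \<in> ?E"
      then obtain A A' B B' where "a = A \<times> B" "b = A' \<times> B'" "A \<in> sets N1" "A' \<in> sets N1" "B \<in> E" "B' \<in> E"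
        by auto
      moreover from this have "A \<inter> A' \<in> sets N1" "B \<inter> B' \<in> E" "a \<inter> b = (A \<inter> A') \<times> (B \<inter> B')"
        using Int_stableD[OF E(2)] by auto
      ultimately show "a \<inter> b \<in> ?E" by blast
    qed
    show "?E \<subseteq> Pow (space N1 \<times> space N2)" by (rule E_sub)
    show "sets J = sigma_sets (space N1 \<times> space N2) ?E" by (simp add: J_def gen)
    show "sets J' = sigma_sets (space N1 \<times> space N2) ?E" by (simp add: sJ' gen)
    show "range (\<lambda>_. space N1 \<times> space N2) \<subseteq> ?E" using E by auto
    show "(\<Union>i::nat. space N1 \<times> space N2) = space N1 \<times> space N2" by auto
    interpret J: prob_space J unfolding J_def by (rule prob_space_distr) simp
    show "emeasure J (space N1 \<times> space N2) \<noteq> \<infinity>" by simp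
    fix C assume "C \<in> ?E"
    then obtain A B where C: "C = A \<times> B" and A[measurable]: "A \<in> sets N1" and BE: "B \<in> E" by auto
    have B[measurable]: "B \<in> sets N2" using BE E(1) by auto
    have "emeasure J C = emeasure M {\<omega> \<in> space M. Y \<omega> \<in> A \<and> V \<omega> \<in> B}"
      unfolding J_def C by (subst emeasure_distr) (auto intro!: arg_cong[where f="emeasure M"])
    also have "\<dots> = (\<integral>\<^sup>+\<omega>. indicator A (Y \<omega>) * emeasure (K (Y \<omega>)) B \<partial>M)"
      by (rule rect[OF A BE])
    also have "\<dots> = (\<integral>\<^sup>+\<omega>. \<integral>\<^sup>+v. indicator C (Y \<omega>, v) \<partial>K (Y \<omega>) \<partial>M)"
    proof (intro nn_integral_cong)
      fix \<omega> assume "\<omega> \<in> space M"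
      then have "B \<in> sets (K (Y \<omega>))" by (simp add: sK Ysp)
      then have "(\<integral>\<^sup>+v. indicator A (Y \<omega>) * indicator B v \<partial>K (Y \<omega>)) = indicator A (Y \<omega>) * emeasure (K (Y \<omega>)) B"
        by (simp add: nn_integral_cmult)
      then show "indicator A (Y \<omega>) * emeasure (K (Y \<omega>)) B = (\<integral>\<^sup>+v. indicator C (Y \<omega>, v) \<partial>K (Y \<omega>))"
        by (simp add: C indicator_times)
    qed
    also have "\<dots> = (\<integral>\<^sup>+w. indicator C w \<partial>J')" by (rule nn[symmetric]) (simp add: C)
    also have "\<dots> = emeasure J' C" by (rule nn_integral_indicator) (simp add: C sJ')
    finally show "emeasure J C = emeasure J' C" .
  qed
  moreover have "(\<integral>\<^sup>+\<omega>. h (Y \<omega>, V \<omega>) \<partial>M) = (\<integral>\<^sup>+w. h w \<partial>J)"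
    unfolding J_def by (subst nn_integral_distr) auto
  ultimately show ?thesis by (simp add: nn)
qed

section \<open>The performative risk around its stable point\<close>

locale performative_risk =
  fixes X :: "'a::euclidean_space set" and S :: "'z::euclidean_space set"
    and loss :: "'a \<Rightarrow> 'z \<Rightarrow> real" and D :: "'a \<Rightarrow> 'z measure"
    and \<mu> L G \<beta> :: real and p :: 'a
  assumes closed_X: "closed X" and convex_X: "convex X"
    and prob_D: "\<And>x. x \<in> X \<Longrightarrow> prob_space (D x)"
    and sets_D: "\<And>x. x \<in> X \<Longrightarrow> sets (D x) = sets (restrict_space borel S)"
    and differentiable_loss:
      "\<And>x z. x \<in> X \<Longrightarrow> z \<in> S \<Longrightarrow> (\<lambda>u. loss u z) differentiable (at x)"
    and integrable_loss: "\<And>x y. x \<in> X \<Longrightarrow> y \<in> X \<Longrightarrow> integrable (D y) (loss x)"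
    and strongly_convex: "\<And>x. x \<in> X \<Longrightarrow> strongly_convex_on \<mu> X (\<lambda>u. decoupled_risk loss D u x)"
    and gradient_Lipschitz: "\<And>x1 x2 z1 z2. x1 \<in> X \<Longrightarrow> x2 \<in> X \<Longrightarrow> z1 \<in> S \<Longrightarrow> z2 \<in> S \<Longrightarrow>
      norm (gradient (\<lambda>u. loss u z1) x1 - gradient (\<lambda>u. loss u z2) x2)
        \<le> L * (norm (x1 - x2) + norm (z1 - z2))"
    and gradient_bound: "\<And>x z. x \<in> X \<Longrightarrow> z \<in> S \<Longrightarrow> norm (gradient (\<lambda>u. loss u z) x) \<le> G"
    and \<beta>_nonneg: "\<beta> \<ge> 0"
    and W1_Lipschitz: "\<And>x y. x \<in> X \<Longrightarrow> y \<in> X \<Longrightarrow> W1 (D x) (D y) \<le> ennreal (\<beta> * norm (x - y))"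
    and L_pos: "L > 0" and contraction: "L * \<beta> < \<mu>"
    and stable: "performatively_stable X loss D p"
begin

definition grad :: "'a \<Rightarrow> 'z \<Rightarrow> 'a" where
  "grad x z = gradient (\<lambda>u. loss u z) x"

definition margin :: real where "margin = \<mu> - L * \<beta>"

lemma margin_pos: "margin > 0"
  using contraction by (simp add: margin_def)

lemma stable_in_X: "p \<in> X"
  using stable by (simp add: performatively_stable_def is_arg_min_def)

lemma space_D: "x \<in> X \<Longrightarrow> space (D x) = S"
  using sets_eq_imp_space_eq[OF sets_D] by (simp add: space_restrict_space)

lemma grad_bound: "x \<in> X \<Longrightarrow> z \<in> S \<Longrightarrow> norm (grad x z) \<le> G"
  unfolding grad_def by (rule gradient_bound)

lemma G_nonneg: "G \<ge> 0"
proof -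
  interpret prob_space "D p" by (rule prob_D[OF stable_in_X])
  obtain z where "z \<in> S" using not_empty space_D[OF stable_in_X] by auto
  from order_trans[OF norm_ge_zero grad_bound[OF stable_in_X this]] show ?thesis .
qed

lemma continuous_on_grad: "continuous_on (X \<times> S) (\<lambda>w. grad (fst w) (snd w))"
proof (rule lipschitz_on_continuous_on[of "2 * L"], rule lipschitz_onI)
  fix v w assume "v \<in> X \<times> S" "w \<in> X \<times> S"
  then have "dist (grad (fst v) (snd v)) (grad (fst w) (snd w)) \<le>
      L * (dist (fst v) (fst w) + dist (snd v) (snd w))"
    unfolding dist_norm grad_def by (intro gradient_Lipschitz) auto
  also have "\<dots> \<le> L * (dist v w + dist v w)"
    using L_pos by (intro mult_left_mono add_mono dist_fst_le dist_snd_le) auto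
  finally show "dist (grad (fst v) (snd v)) (grad (fst w) (snd w)) \<le> 2 * L * dist v w" by simp
qed (use L_pos in auto)

text \<open>
  The gradient is only under control at points of \<open>X\<close> and \<open>S\<close>, so measurability is stated for
  maps with values in these sets, which need not be Borel in the case of \<open>S\<close>.
\<close>

lemma measurable_grad:
  assumes f: "f \<in> N \<rightarrow>\<^sub>M borel" "\<And>w. w \<in> space N \<Longrightarrow> f w \<in> X"
    and h: "h \<in> N \<rightarrow>\<^sub>M borel" "\<And>w. w \<in> space N \<Longrightarrow> h w \<in> S"
  shows "(\<lambda>w. grad (f w) (h w)) \<in> borel_measurable N"
proof -
  have "(\<lambda>w. (f w, h w)) \<in> N \<rightarrow>\<^sub>M restrict_space borel (X \<times> S)"
    using f h by (intro measurable_restrict_space2) auto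
  from measurable_compose[OF this borel_measurable_continuous_on_restrict[OF continuous_on_grad]]
  show ?thesis by simp
qed

lemma measurable_id_D: "x \<in> X \<Longrightarrow> (\<lambda>z. z) \<in> D x \<rightarrow>\<^sub>M borel"
  by (subst measurable_cong_sets[OF sets_D refl]) (auto intro: measurable_restrict_space1)

lemma measurable_grad_D [measurable]: "x \<in> X \<Longrightarrow> y \<in> X \<Longrightarrow> grad x \<in> borel_measurable (D y)"
  by (rule measurable_grad) (auto simp: space_D measurable_id_D)

lemma integrable_inner_grad:
  assumes "x \<in> X" "y \<in> X" shows "integrable (D y) (\<lambda>z. grad x z \<bullet> v)"
proof -
  interpret prob_space "D y" by (rule prob_D) fact
  show ?thesis
  proof (rule integrable_const_bound[where B="G * norm v"])
    show "AE z in D y. norm (grad x z \<bullet> v) \<le> G * norm v"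
      using order_trans[OF Cauchy_Schwarz_ineq2 mult_right_mono[OF grad_bound[OF assms(1)] norm_ge_zero]]
      by (intro AE_I2) (simp add: space_D assms)
  qed (use assms in measurable)
qed

lemma expected_grad_shift:
  assumes "x \<in> X" "y \<in> X"
  shows "\<bar>(\<integral>z. grad x z \<bullet> v \<partial>D x) - (\<integral>z. grad x z \<bullet> v \<partial>D y)\<bar> \<le> L * norm v * (\<beta> * norm (x - y))"
proof (rule integral_diff_le_W1[where b="G * norm v"])
  fix z z' assume z: "z \<in> S" "z' \<in> S"
  have "\<bar>grad x z \<bullet> v - grad x z' \<bullet> v\<bar> \<le> norm (grad x z - grad x z') * norm v"
    using Cauchy_Schwarz_ineq2[of "grad x z - grad x z'" v] by (simp add: inner_diff_left)
  also have "\<dots> \<le> (L * norm (z - z')) * norm v"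
    using gradient_Lipschitz[of x x z z'] assms z by (intro mult_right_mono) (auto simp: grad_def)
  finally show "\<bar>grad x z \<bullet> v - grad x z' \<bullet> v\<bar> \<le> L * norm v * norm (z - z')"
    by (simp add: mult_ac)
next
  fix z assume z: "z \<in> S"
  show "\<bar>grad x z \<bullet> v\<bar> \<le> G * norm v"
    by (rule order_trans[OF Cauchy_Schwarz_ineq2 mult_right_mono[OF grad_bound norm_ge_zero]])
      (use assms z in auto)
qed (use assms L_pos \<beta>_nonneg prob_D sets_D W1_Lipschitz in auto)

text \<open>
  Adding the strong convexity inequalities at \<open>x\<close> and at \<open>p\<close> gives strong monotonicity of the
  derivative. The slope at \<open>p\<close> towards \<open>x\<close> is nonnegative because \<open>p\<close> minimises the risk under its
  own law, so it can be dropped.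
\<close>

lemma expected_grad_at_stable_law:
  assumes x: "x \<in> X"
  shows "\<mu> * (norm (x - p))\<^sup>2 \<le> (\<integral>z. grad x z \<bullet> (x - p) \<partial>D p)"
proof -
  note p = stable_in_X
  define F where "F u = decoupled_risk loss D u p" for u
  have F_integral: "F = (\<lambda>u. \<integral>z. loss u z \<partial>D p)" by (simp add: F_def decoupled_risk_def fun_eq_iff)
  have "strongly_convex_on \<mu> X F" using strongly_convex[OF p] by (simp add: F_def[abs_def])
  then obtain v v' where
    v: "(F has_derivative (\<lambda>h. v \<bullet> h)) (at x within X)"
      "F p \<ge> F x + v \<bullet> (p - x) + \<mu> / 2 * (norm (p - x))\<^sup>2"
    and v': "(F has_derivative (\<lambda>h. v' \<bullet> h)) (at p within X)"
      "F x \<ge> F p + v' \<bullet> (x - p) + \<mu> / 2 * (norm (x - p))\<^sup>2"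
    unfolding strongly_convex_on_def using x p by metis
  have "v' \<bullet> (x - p) \<ge> 0"
  proof (rule tendsto_lowerbound[OF difference_quotient_tendsto[OF v'(1) convex_X p x]])
    have "F p \<le> F (p + inverse (real (Suc n)) *\<^sub>R (x - p))" for n
    proof -
      have "(1 - inverse (real (Suc n))) *\<^sub>R p + inverse (real (Suc n)) *\<^sub>R x \<in> X"
        using convex_X p x by (intro convexD) (auto simp: field_simps)
      moreover have "(1 - inverse (real (Suc n))) *\<^sub>R p + inverse (real (Suc n)) *\<^sub>R x =
          p + inverse (real (Suc n)) *\<^sub>R (x - p)" by (simp add: algebra_simps)
      ultimately show ?thesis
        using stable unfolding performatively_stable_def is_arg_min_def F_def by (metis not_le)
    qed
    then show "\<forall>\<^sub>F n in sequentially. 0 \<le> (F (p + inverse (real (Suc n)) *\<^sub>R (x - p)) - F p) / inverse (real (Suc n))"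
      by (intro always_eventually) auto
  qed simp
  moreover have "norm (p - x) = norm (x - p)" by (rule norm_minus_commute)
  ultimately have "\<mu> * (norm (x - p))\<^sup>2 \<le> - (v \<bullet> (p - x))" using v(2) v'(2) by simp
  also have "v \<bullet> (p - x) = (\<integral>z. grad x z \<bullet> (p - x) \<partial>D p)"
    unfolding grad_def
    by (rule inner_derivative_expected_loss[OF prob_D[OF p] convex_X x p _ _ _ v(1)[unfolded F_integral]])
      (use p differentiable_loss integrable_loss gradient_bound in \<open>auto simp: space_D\<close>)
  also have "- \<dots> = (\<integral>z. grad x z \<bullet> (x - p) \<partial>D p)"
    by (simp flip: integral_minus inner_minus_right)
  finally show ?thesis .
qed

text \<open>
  The decisive inequality: passing from the law \<open>D p\<close> to the deployed law \<open>D x\<close> costs \<open>L * \<beta>\<close>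
  of the modulus \<open>\<mu>\<close>.
\<close>

lemma expected_grad_monotone:
  assumes x: "x \<in> X"
  shows "margin * (norm (x - p))\<^sup>2 \<le> (\<integral>z. grad x z \<bullet> (x - p) \<partial>D x)"
  using expected_grad_at_stable_law[OF x] expected_grad_shift[OF x stable_in_X, of "x - p"]
  by (simp add: margin_def power2_eq_square algebra_simps)

text \<open>
  Since gradients are bounded, strong monotonicity can only hold on a bounded set.
\<close>

lemma dist_stable_le:
  assumes x: "x \<in> X"
  shows "norm (x - p) \<le> G / margin"
proof (cases "x = p")
  case True
  then show ?thesis using G_nonneg margin_pos by simp
next
  case False
  interpret prob_space "D x" by (rule prob_D[OF x])
  have "margin * (norm (x - p))\<^sup>2 \<le> (\<integral>z. grad x z \<bullet> (x - p) \<partial>D x)"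
    by (rule expected_grad_monotone[OF x])
  also have "\<dots> \<le> (\<integral>z. G * norm (x - p) \<partial>D x)"
  proof (rule integral_mono)
    fix z assume "z \<in> space (D x)"
    then show "grad x z \<bullet> (x - p) \<le> G * norm (x - p)"
      using order_trans[OF norm_cauchy_schwarz mult_right_mono[OF grad_bound[OF x] norm_ge_zero]]
      by (simp add: space_D x)
  qed (use x integrable_inner_grad in auto)
  also have "\<dots> = G * norm (x - p)" by (simp add: prob_space)
  finally have "margin * norm (x - p) \<le> G"
    using False by (simp add: power2_eq_square)
  then show ?thesis using margin_pos by (simp add: field_simps)
qed

text \<open>
  Expected squared error, before projection, of a step of size \<open>\<eta>\<close> from a deterministic point
  \<open>x\<close>. The first part records that the bound is nonnegative, which is not evident when
  \<open>margin * \<eta> > 1\<close> and is needed since the second part compares extended nonnegative reals, where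
  \<open>ennreal\<close> would turn a negative bound into zero.
\<close>

lemma one_step_bound:
  assumes x: "x \<in> X" and c: "c > 0" and \<sigma>: "\<sigma> \<ge> 0" and \<eta>: "\<eta> \<ge> 0"
  shows "0 \<le> (1 - margin * \<eta>) * (norm (x - p))\<^sup>2 + \<eta>\<^sup>2 * (c\<^sup>2 + real DIM('a) * \<sigma>\<^sup>2)
        + \<eta> * (max (G - c) 0)\<^sup>2 / margin"
    and "(\<integral>\<^sup>+w. ennreal ((norm (x - p - \<eta> *\<^sub>R (clip c (grad x (fst w)) + snd w)))\<^sup>2)
      \<partial>(D x \<Otimes>\<^sub>M isotropic_gaussian \<sigma>))
    \<le> ennreal ((1 - margin * \<eta>) * (norm (x - p))\<^sup>2 + \<eta>\<^sup>2 * (c\<^sup>2 + real DIM('a) * \<sigma>\<^sup>2)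
        + \<eta> * (max (G - c) 0)\<^sup>2 / margin)"
proof -
  interpret D: prob_space "D x" by (rule prob_D[OF x])
  interpret N: prob_space "isotropic_gaussian \<sigma> :: 'a measure" by (rule prob_space_isotropic_gaussian[OF \<sigma>])
  define e where "e = x - p"
  define B where "B = max (G - c) 0"
  define k where "k z = clip c (grad x z)" for z
  define d where "d = real DIM('a) * \<sigma>\<^sup>2"
  have d: "d \<ge> 0" by (simp add: d_def)
  have clip_meas: "clip c \<in> borel_measurable borel"
    by (rule borel_measurable_continuous_onI[OF continuous_on_clip[OF c]])
  have [measurable]: "k \<in> borel_measurable (D x)"
    unfolding k_def by (rule measurable_compose[OF measurable_grad_D[OF x x] clip_meas])
  have pointwise: "(norm (e - \<eta> *\<^sub>R k z))\<^sup>2 + \<eta>\<^sup>2 * d \<le>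
      (norm e)\<^sup>2 - 2 * \<eta> * (grad x z \<bullet> e) + 2 * \<eta> * (B * norm e) + \<eta>\<^sup>2 * (c\<^sup>2 + d)" (is "_ \<le> ?u z")
    if z: "z \<in> S" for z
  proof -
    have "- (B * norm e) \<le> (k z - grad x z) \<bullet> e"
    proof -
      have "\<bar>(k z - grad x z) \<bullet> e\<bar> \<le> norm (k z - grad x z) * norm e" by (rule Cauchy_Schwarz_ineq2)
      also have "\<dots> \<le> B * norm e"
        unfolding k_def B_def by (intro mult_right_mono norm_clip_minus_le c grad_bound x z) simp
      finally show ?thesis by linarith
    qed
    then have "2 * \<eta> * (grad x z \<bullet> e - B * norm e) \<le> 2 * \<eta> * (k z \<bullet> e)"
      using \<eta> by (intro mult_left_mono) (auto simp: inner_diff_left)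
    moreover have "\<eta>\<^sup>2 * (norm (k z))\<^sup>2 \<le> \<eta>\<^sup>2 * c\<^sup>2"
      unfolding k_def by (intro mult_left_mono power_mono norm_clip_le c) auto
    moreover have "(norm (e - \<eta> *\<^sub>R k z))\<^sup>2 = (norm e)\<^sup>2 - 2 * \<eta> * (k z \<bullet> e) + \<eta>\<^sup>2 * (norm (k z))\<^sup>2"
      unfolding power2_norm_eq_inner
      by (simp add: inner_diff_left inner_diff_right inner_commute power2_eq_square algebra_simps)
    ultimately show ?thesis by (simp add: algebra_simps)
  qed
  have u_nonneg: "?u z \<ge> 0" if "z \<in> S" for z
    by (rule order_trans[OF _ pointwise[OF that]]) (simp add: d)
  have u_int: "integrable (D x) ?u"
    using integrable_inner_grad[OF x x] by auto
  have u_le: "(\<integral>z. ?u z \<partial>D x) \<le> (1 - margin * \<eta>) * (norm e)\<^sup>2 + \<eta>\<^sup>2 * (c\<^sup>2 + d) + \<eta> * B\<^sup>2 / margin"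
  proof -
    have "(\<integral>z. ?u z \<partial>D x) = (norm e)\<^sup>2 - 2 * \<eta> * (\<integral>z. grad x z \<bullet> e \<partial>D x) + 2 * \<eta> * (B * norm e) + \<eta>\<^sup>2 * (c\<^sup>2 + d)"
      using integrable_inner_grad[OF x x] by (simp add: D.prob_space)
    moreover have "2 * \<eta> * (margin * (norm e)\<^sup>2) \<le> 2 * \<eta> * (\<integral>z. grad x z \<bullet> e \<partial>D x)"
      using expected_grad_monotone[OF x] \<eta> by (intro mult_left_mono) (auto simp: e_def)
    moreover have "2 * \<eta> * (B * norm e) \<le> \<eta> * (margin * (norm e)\<^sup>2 + B\<^sup>2 / margin)"
    proof -
      have "0 \<le> (margin * norm e - B)\<^sup>2 / margin" using margin_pos by simp
      also have "\<dots> = margin * (norm e)\<^sup>2 + B\<^sup>2 / margin - 2 * (B * norm e)"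
        using margin_pos by (simp add: power2_eq_square field_simps)
      finally have "\<eta> * (2 * (B * norm e)) \<le> \<eta> * (margin * (norm e)\<^sup>2 + B\<^sup>2 / margin)"
        using \<eta> by (intro mult_left_mono) auto
      then show ?thesis by (simp add: mult_ac)
    qed
    ultimately show ?thesis
      by (simp add: algebra_simps)
  qed
  have "0 \<le> (\<integral>z. ?u z \<partial>D x)"
    by (rule integral_nonneg_AE) (use u_nonneg in \<open>auto simp: space_D x\<close>)
  also note u_le
  finally show "0 \<le> (1 - margin * \<eta>) * (norm (x - p))\<^sup>2 + \<eta>\<^sup>2 * (c\<^sup>2 + real DIM('a) * \<sigma>\<^sup>2)
        + \<eta> * (max (G - c) 0)\<^sup>2 / margin"
    by (simp add: e_def d_def B_def)
  have w: "e - \<eta> *\<^sub>R (k z + y) = (e - \<eta> *\<^sub>R k z) + (- \<eta>) *\<^sub>R y" for z y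
    by (simp add: algebra_simps)
  have "(\<integral>\<^sup>+w. ennreal ((norm (e - \<eta> *\<^sub>R (k (fst w) + snd w)))\<^sup>2) \<partial>(D x \<Otimes>\<^sub>M isotropic_gaussian \<sigma>)) =
      (\<integral>\<^sup>+z. \<integral>\<^sup>+y. ennreal ((norm (e - \<eta> *\<^sub>R (k z + y)))\<^sup>2) \<partial>isotropic_gaussian \<sigma> \<partial>D x)"
    by (subst N.nn_integral_fst[symmetric]) auto
  also have "\<dots> = (\<integral>\<^sup>+z. ennreal ((norm (e - \<eta> *\<^sub>R k z))\<^sup>2 + \<eta>\<^sup>2 * d) \<partial>D x)"
    unfolding w by (subst nn_integral_isotropic_gaussian_shift[OF \<sigma>]) (simp add: d_def)
  also have "\<dots> \<le> (\<integral>\<^sup>+z. ennreal (?u z) \<partial>D x)"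
    by (intro nn_integral_mono ennreal_leI pointwise) (simp add: space_D x)
  also have "\<dots> = ennreal (\<integral>z. ?u z \<partial>D x)"
    by (intro nn_integral_eq_integral u_int AE_I2 u_nonneg) (simp add: space_D x)
  also have "\<dots> \<le> ennreal ((1 - margin * \<eta>) * (norm e)\<^sup>2 + \<eta>\<^sup>2 * (c\<^sup>2 + d) + \<eta> * B\<^sup>2 / margin)"
    by (rule ennreal_leI) (rule u_le)
  finally show "(\<integral>\<^sup>+w. ennreal ((norm (x - p - \<eta> *\<^sub>R (clip c (grad x (fst w)) + snd w)))\<^sup>2)
      \<partial>(D x \<Otimes>\<^sub>M isotropic_gaussian \<sigma>))
    \<le> ennreal ((1 - margin * \<eta>) * (norm (x - p))\<^sup>2 + \<eta>\<^sup>2 * (c\<^sup>2 + real DIM('a) * \<sigma>\<^sup>2)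
        + \<eta> * (max (G - c) 0)\<^sup>2 / margin)"
    by (simp add: e_def k_def d_def B_def)
qed

lemma measurable_D: "D \<in> restrict_space borel X \<rightarrow>\<^sub>M prob_algebra (restrict_space borel S)"
  by (rule measurable_kernel_if_W1_Lipschitz[OF prob_D sets_D \<beta>_nonneg W1_Lipschitz])

end

section \<open>Projected clipped gradient descent\<close>

locale clipped_sgd = performative_risk X S loss D \<mu> L G \<beta> p + prob_space M
  for X :: "'a::euclidean_space set" and S :: "'z::euclidean_space set" and loss D \<mu> L G \<beta> p
    and M :: "'w measure" +
  fixes \<gamma> :: "nat \<Rightarrow> real" and c \<sigma> :: real and \<theta>0 :: 'a
    and Z :: "nat \<Rightarrow> 'w \<Rightarrow> 'z" and \<zeta> \<theta> :: "nat \<Rightarrow> 'w \<Rightarrow> 'a"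
  assumes \<gamma>_pos: "\<And>s. s \<ge> 1 \<Longrightarrow> \<gamma> s > 0" and c_pos: "c > 0" and \<sigma>_nonneg: "\<sigma> \<ge> 0"
    and start: "\<theta>0 \<in> X"
    and sgd: "projected_clipped_sgd M X S loss D \<gamma> c \<sigma> \<theta>0 Z \<zeta> \<theta>"
begin

lemma measurable_sample [measurable]: "Z (Suc t) \<in> M \<rightarrow>\<^sub>M restrict_space borel S"
  and measurable_noise [measurable]: "\<zeta> (Suc t) \<in> M \<rightarrow>\<^sub>M borel"
  using sgd by (auto simp: projected_clipped_sgd_def)

lemma sample_in_S: "\<omega> \<in> space M \<Longrightarrow> Z (Suc t) \<omega> \<in> S"
  using measurable_space[OF measurable_sample] by (simp add: space_restrict_space)

lemma iterate_0: "\<omega> \<in> space M \<Longrightarrow> \<theta> 0 \<omega> = \<theta>0"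
  using sgd by (auto simp: projected_clipped_sgd_def)

lemma iterate_Suc: "\<omega> \<in> space M \<Longrightarrow> \<theta> (Suc t) \<omega> =
    closest_point X (\<theta> t \<omega> - \<gamma> (Suc t) *\<^sub>R (clip c (grad (\<theta> t \<omega>) (Z (Suc t) \<omega>)) + \<zeta> (Suc t) \<omega>))"
  using sgd by (auto simp: projected_clipped_sgd_def grad_def)

lemma X_nonempty: "X \<noteq> {}"
  using start by auto

lemma iterate_in_X: "\<omega> \<in> space M \<Longrightarrow> \<theta> t \<omega> \<in> X"
  by (cases t) (auto simp: iterate_0 iterate_Suc start closest_point_in_set closed_X X_nonempty)

lemma space_past [simp]: "space (past M Z \<zeta> t) = space M"
  by (simp add: past_def)

lemma measurable_past_component:
  assumes "s \<in> {1..t}"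
  shows "(\<lambda>\<omega>. (Z s \<omega>, \<zeta> s \<omega>)) \<in> past M Z \<zeta> t \<rightarrow>\<^sub>M borel \<Otimes>\<^sub>M borel"
proof -
  let ?f = "\<lambda>\<omega>. \<lambda>s\<in>{1..t}. (Z s \<omega>, \<zeta> s \<omega>)"
  have "?f \<in> past M Z \<zeta> t \<rightarrow>\<^sub>M (\<Pi>\<^sub>M s\<in>{1..t}. borel \<Otimes>\<^sub>M borel)"
    unfolding past_def by (rule measurable_vimage_algebra1) (auto simp: space_PiM space_pair_measure)
  from measurable_compose[OF this measurable_component_singleton[OF assms]]
  show ?thesis using assms by (simp only: restrict_apply if_True)
qed

lemma subalgebra_past: "subalgebra M (past M Z \<zeta> t)"
  unfolding subalgebra_def
proof
  have "(\<lambda>\<omega>. \<lambda>s\<in>{1..t}. (Z s \<omega>, \<zeta> s \<omega>)) \<in> M \<rightarrow>\<^sub>M (\<Pi>\<^sub>M s\<in>{1..t}. borel \<Otimes>\<^sub>M borel)"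
  proof (rule measurable_restrict)
    fix s assume "s \<in> {1..t}"
    then obtain r where s: "s = Suc r" by (cases s) auto
    have "Z (Suc r) \<in> M \<rightarrow>\<^sub>M borel"
      using measurable_sample[of r] by (simp add: measurable_restrict_space2_iff)
    then show "(\<lambda>\<omega>. (Z s \<omega>, \<zeta> s \<omega>)) \<in> M \<rightarrow>\<^sub>M borel \<Otimes>\<^sub>M borel"
      unfolding s by measurable
  qed
  then show "sets (past M Z \<zeta> t) \<subseteq> sets M"
    unfolding past_def by (intro sets_image_in_sets) auto
qed simp

lemma measurable_clip [measurable]: "clip c \<in> borel_measurable borel"
  by (rule borel_measurable_continuous_onI[OF continuous_on_clip[OF c_pos]])

lemma measurable_projection: "closest_point X \<in> borel_measurable borel"
  by (rule borel_measurable_continuous_onI)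
    (rule continuous_on_closest_point[OF convex_X closed_X X_nonempty])

lemma measurable_iterate_past:
  "t \<le> t' \<Longrightarrow> \<theta> t \<in> past M Z \<zeta> t' \<rightarrow>\<^sub>M borel"
proof (induction t)
  case 0
  then show ?case by (subst measurable_cong[of _ _ "\<lambda>_. \<theta>0"]) (auto simp: iterate_0)
next
  case (Suc t)
  have \<theta>: "\<theta> t \<in> past M Z \<zeta> t' \<rightarrow>\<^sub>M borel" using Suc by simp
  have Z\<zeta>: "(\<lambda>\<omega>. (Z (Suc t) \<omega>, \<zeta> (Suc t) \<omega>)) \<in> past M Z \<zeta> t' \<rightarrow>\<^sub>M borel \<Otimes>\<^sub>M borel"
    by (rule measurable_past_component) (use Suc.prems in auto)
  have Z: "Z (Suc t) \<in> past M Z \<zeta> t' \<rightarrow>\<^sub>M borel" and [measurable]: "\<zeta> (Suc t) \<in> past M Z \<zeta> t' \<rightarrow>\<^sub>M borel"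
    using measurable_compose[OF Z\<zeta> measurable_fst] measurable_compose[OF Z\<zeta> measurable_snd] by auto
  have [measurable]: "(\<lambda>\<omega>. grad (\<theta> t \<omega>) (Z (Suc t) \<omega>)) \<in> past M Z \<zeta> t' \<rightarrow>\<^sub>M borel"
    by (rule measurable_grad[OF \<theta> _ Z]) (auto simp: iterate_in_X sample_in_S)
  have "(\<lambda>\<omega>. \<theta> t \<omega> - \<gamma> (Suc t) *\<^sub>R (clip c (grad (\<theta> t \<omega>) (Z (Suc t) \<omega>)) + \<zeta> (Suc t) \<omega>))
      \<in> past M Z \<zeta> t' \<rightarrow>\<^sub>M borel"
    using \<theta> by measurable
  from measurable_compose[OF this measurable_projection] show ?case
    by (subst measurable_cong[OF iterate_Suc]) auto
qed

lemma measurable_iterate: "\<theta> t \<in> M \<rightarrow>\<^sub>M borel"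
  by (rule measurable_from_subalg[OF subalgebra_past measurable_iterate_past[OF order_refl]])

lemma measurable_iterate_X: "\<theta> t \<in> M \<rightarrow>\<^sub>M restrict_space borel X"
  by (rule measurable_restrict_space2) (auto simp: iterate_in_X measurable_iterate)

abbreviation step_law :: "'a \<Rightarrow> ('z \<times> 'a) measure" where
  "step_law x \<equiv> D x \<Otimes>\<^sub>M isotropic_gaussian \<sigma>"

lemma measurable_step_law:
  "step_law \<in> restrict_space borel X \<rightarrow>\<^sub>M prob_algebra (restrict_space borel S \<Otimes>\<^sub>M borel)"
proof (rule measurable_pair_prob[OF measurable_D measurable_const])
  show "isotropic_gaussian \<sigma> \<in> space (prob_algebra borel)"
    by (simp add: space_prob_algebra prob_space_isotropic_gaussian \<sigma>_nonneg)
qed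

text \<open>
  The prescribed conditional probabilities, integrated over an event \<open>\<theta> t \<in> E\<close> of the past.
  Because the kernel is measurable, the almost sure equality of the conditional probability with
  \<open>D (\<theta> t) A * N(B)\<close> can be integrated; it holds separately for each \<open>A\<close> and \<open>B\<close>, and no regular
  version of the conditional law has to be chosen.
\<close>

lemma step_law_rectangle:
  assumes E: "E \<in> sets (restrict_space borel X)"
    and A: "A \<in> sets (restrict_space borel S)" and B: "B \<in> sets borel"
  shows "emeasure M {\<omega> \<in> space M. \<theta> t \<omega> \<in> E \<and> (Z (Suc t) \<omega>, \<zeta> (Suc t) \<omega>) \<in> A \<times> B} =
    (\<integral>\<^sup>+\<omega>. indicator E (\<theta> t \<omega>) * emeasure (step_law (\<theta> t \<omega>)) (A \<times> B) \<partial>M)"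
proof -
  interpret N: prob_space "isotropic_gaussian \<sigma> :: 'a measure"
    by (rule prob_space_isotropic_gaussian[OF \<sigma>_nonneg])
  interpret finite_measure_subalgebra M "past M Z \<zeta> t"
    by unfold_locales (rule subalgebra_past)
  let ?H = "{\<omega> \<in> space M. Z (Suc t) \<omega> \<in> A \<and> \<zeta> (Suc t) \<omega> \<in> B}"
  let ?F = "\<theta> t -` E \<inter> space M"
  let ?q = "\<lambda>\<omega>. measure (D (\<theta> t \<omega>)) A * measure (isotropic_gaussian \<sigma> :: 'a measure) B"
  have F: "?F \<in> sets (past M Z \<zeta> t)"
  proof -
    have "\<theta> t \<in> past M Z \<zeta> t \<rightarrow>\<^sub>M restrict_space borel X"
      by (rule measurable_restrict_space2) (auto simp: iterate_in_X measurable_iterate_past)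
    from measurable_sets[OF this E] show ?thesis by simp
  qed
  then have F_M[measurable]: "?F \<in> sets M" using subalgebra_past by (auto simp: subalgebra_def)
  have H[measurable]: "?H \<in> sets M" using A B by measurable
  have D_meas: "(\<lambda>x. measure (D x) A) \<in> borel_measurable (restrict_space borel X)"
    by (rule measurable_compose[OF measurable_D measurable_measure_prob_algebra[OF A]])
  have q[measurable]: "?q \<in> borel_measurable M"
    using measurable_compose[OF measurable_iterate_X D_meas] by measurable
  have q1: "0 \<le> ?q \<omega>" "?q \<omega> \<le> 1" if "\<omega> \<in> space M" for \<omega>
  proof -
    interpret D: prob_space "D (\<theta> t \<omega>)" by (rule prob_D[OF iterate_in_X[OF that]])
    show "0 \<le> ?q \<omega>" by simp
    show "?q \<omega> \<le> 1" by (intro mult_le_one D.prob_le_1 N.prob_le_1) simp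
  qed
  have int_q: "integrable M (\<lambda>\<omega>. indicator ?F \<omega> * ?q \<omega>)"
  proof (rule integrable_const_bound[where B=1])
    show "AE \<omega> in M. norm (indicator ?F \<omega> * ?q \<omega>) \<le> 1"
      using q1 by (intro AE_I2) (auto simp: indicator_def)
  qed measurable
  have law: "AE \<omega> in M. real_cond_exp M (past M Z \<zeta> t) (indicat_real ?H) \<omega> = ?q \<omega>"
    using sgd A B by (auto simp: projected_clipped_sgd_def)
  have "measure M (?F \<inter> ?H) = (\<integral>\<omega>. indicator ?F \<omega> * indicat_real ?H \<omega> \<partial>M)"
    by (simp flip: indicator_inter_arith)
  also have "\<dots> = (\<integral>\<omega>\<in>?F. indicat_real ?H \<omega> \<partial>M)" by (simp add: set_lebesgue_integral_def)
  also have "\<dots> = (\<integral>\<omega>\<in>?F. real_cond_exp M (past M Z \<zeta> t) (indicat_real ?H) \<omega> \<partial>M)"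
    by (rule real_cond_exp_intA[OF _ F]) (simp add: less_top[symmetric])
  also have "\<dots> = (\<integral>\<omega>\<in>?F. ?q \<omega> \<partial>M)"
    unfolding set_lebesgue_integral_def
    by (rule integral_cong_AE) (use law in \<open>auto elim: eventually_mono\<close>)
  also have "\<dots> = (\<integral>\<omega>. indicator ?F \<omega> * ?q \<omega> \<partial>M)"
    by (simp only: set_lebesgue_integral_def real_scaleR_def)
  finally have eq: "measure M (?F \<inter> ?H) = (\<integral>\<omega>. indicator ?F \<omega> * ?q \<omega> \<partial>M)" .
  have "{\<omega> \<in> space M. \<theta> t \<omega> \<in> E \<and> (Z (Suc t) \<omega>, \<zeta> (Suc t) \<omega>) \<in> A \<times> B} = ?F \<inter> ?H" by auto
  then have "emeasure M {\<omega> \<in> space M. \<theta> t \<omega> \<in> E \<and> (Z (Suc t) \<omega>, \<zeta> (Suc t) \<omega>) \<in> A \<times> B} =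
      ennreal (\<integral>\<omega>. indicator ?F \<omega> * ?q \<omega> \<partial>M)"
    using eq by (simp only: emeasure_eq_measure)
  also have "\<dots> = (\<integral>\<^sup>+\<omega>. ennreal (indicator ?F \<omega> * ?q \<omega>) \<partial>M)"
    by (rule nn_integral_eq_integral[symmetric, OF int_q]) (use q1 in \<open>auto intro!: AE_I2\<close>)
  also have "\<dots> = (\<integral>\<^sup>+\<omega>. indicator E (\<theta> t \<omega>) * emeasure (step_law (\<theta> t \<omega>)) (A \<times> B) \<partial>M)"
  proof (rule nn_integral_cong)
    fix \<omega> assume w: "\<omega> \<in> space M"
    interpret D: prob_space "D (\<theta> t \<omega>)" by (rule prob_D[OF iterate_in_X[OF w]])
    have "A \<in> sets (D (\<theta> t \<omega>))" using A by (simp add: sets_D iterate_in_X w)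
    then have "emeasure (step_law (\<theta> t \<omega>)) (A \<times> B) = ennreal (?q \<omega>)"
      using B by (simp add: N.emeasure_pair_measure_Times D.emeasure_eq_measure
          N.emeasure_eq_measure ennreal_mult)
    then show "ennreal (indicator ?F \<omega> * ?q \<omega>) = indicator E (\<theta> t \<omega>) * emeasure (step_law (\<theta> t \<omega>)) (A \<times> B)"
      using w by (simp add: indicator_def)
  qed
  finally show ?thesis .
qed

lemma nn_integral_step:
  assumes h: "h \<in> borel_measurable (restrict_space borel X \<Otimes>\<^sub>M (restrict_space borel S \<Otimes>\<^sub>M borel))"
  shows "(\<integral>\<^sup>+\<omega>. h (\<theta> t \<omega>, Z (Suc t) \<omega>, \<zeta> (Suc t) \<omega>) \<partial>M) =
    (\<integral>\<^sup>+\<omega>. \<integral>\<^sup>+w. h (\<theta> t \<omega>, w) \<partial>step_law (\<theta> t \<omega>) \<partial>M)"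
proof (rule nn_integral_disintegration[where V="\<lambda>\<omega>. (Z (Suc t) \<omega>, \<zeta> (Suc t) \<omega>)" and
    E="{A \<times> B |A B. A \<in> sets (restrict_space borel S) \<and> B \<in> sets borel}",
    OF prob_space_axioms measurable_iterate_X _ measurable_step_law _ _ _ _ _ h])
  let ?N = "restrict_space borel S" and ?B = "borel :: 'a measure"
  let ?E = "{A \<times> B |A B. A \<in> sets ?N \<and> B \<in> sets ?B}"
  show "(\<lambda>\<omega>. (Z (Suc t) \<omega>, \<zeta> (Suc t) \<omega>)) \<in> M \<rightarrow>\<^sub>M ?N \<Otimes>\<^sub>M ?B" by measurable
  show "sets (?N \<Otimes>\<^sub>M ?B) = sigma_sets (space (?N \<Otimes>\<^sub>M ?B)) ?E"
    by (simp add: sets_pair_measure space_pair_measure)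
  show "Int_stable ?E" by (rule Int_stable_pair_measure_generator)
  show "?E \<subseteq> Pow (space (?N \<Otimes>\<^sub>M ?B))"
    using pair_measure_closed[of ?N ?B] by (simp add: space_pair_measure)
  show "space (?N \<Otimes>\<^sub>M ?B) \<in> ?E"
    unfolding space_pair_measure using sets.top[of ?N] sets.top[of ?B] by blast
  fix E R assume "E \<in> sets (restrict_space borel X)" "R \<in> ?E"
  then show "emeasure M {\<omega> \<in> space M. \<theta> t \<omega> \<in> E \<and> (Z (Suc t) \<omega>, \<zeta> (Suc t) \<omega>) \<in> R} =
      (\<integral>\<^sup>+\<omega>. indicator E (\<theta> t \<omega>) * emeasure (step_law (\<theta> t \<omega>)) R \<partial>M)"
    using step_law_rectangle by blast
qed

definition mse :: "nat \<Rightarrow> real" where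
  "mse t = (\<integral>\<omega>. (norm (\<theta> t \<omega> - p))\<^sup>2 \<partial>M)"

lemma sq_error_le: "\<omega> \<in> space M \<Longrightarrow> (norm (\<theta> t \<omega> - p))\<^sup>2 \<le> (G / margin)\<^sup>2"
  by (intro power_mono dist_stable_le iterate_in_X) auto

lemma integrable_sq_error: "integrable M (\<lambda>\<omega>. (norm (\<theta> t \<omega> - p))\<^sup>2)"
proof (rule integrable_const_bound[where B="(G / margin)\<^sup>2"])
  show "AE \<omega> in M. norm ((norm (\<theta> t \<omega> - p))\<^sup>2) \<le> (G / margin)\<^sup>2"
    using sq_error_le by (intro AE_I2) auto
  show "(\<lambda>\<omega>. (norm (\<theta> t \<omega> - p))\<^sup>2) \<in> borel_measurable M"
    using measurable_iterate[of t] by measurable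
qed

lemma mse_le: "mse t \<le> (G / margin)\<^sup>2"
proof -
  have "mse t \<le> (\<integral>\<omega>. (G / margin)\<^sup>2 \<partial>M)"
    unfolding mse_def by (intro integral_mono integrable_sq_error sq_error_le) auto
  then show ?thesis by (simp add: prob_space)
qed

lemma mse_0: "mse 0 = (norm (\<theta>0 - p))\<^sup>2"
proof -
  have "mse 0 = (\<integral>\<omega>. (norm (\<theta>0 - p))\<^sup>2 \<partial>M)"
    unfolding mse_def by (rule Bochner_Integration.integral_cong) (auto simp: iterate_0)
  then show ?thesis by (simp add: prob_space)
qed

text \<open>
  Projection onto \<open>X\<close> does not increase the distance to \<open>p \<in> X\<close>, so the pointwise one-step bound can
  be averaged over the law of the current iterate.
\<close>

lemma mse_recursion:
  "mse (Suc t) \<le> (1 - margin * \<gamma> (Suc t)) * mse t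
    + (\<gamma> (Suc t))\<^sup>2 * (c\<^sup>2 + real DIM('a) * \<sigma>\<^sup>2) + \<gamma> (Suc t) * (max (G - c) 0)\<^sup>2 / margin"
proof -
  let ?\<eta> = "\<gamma> (Suc t)"
  let ?b = "?\<eta>\<^sup>2 * (c\<^sup>2 + real DIM('a) * \<sigma>\<^sup>2) + ?\<eta> * (max (G - c) 0)\<^sup>2 / margin"
  have \<eta>: "?\<eta> > 0" by (rule \<gamma>_pos) simp
  let ?r = "\<lambda>x. (1 - margin * ?\<eta>) * (norm (x - p))\<^sup>2 + ?b"
  let ?h = "\<lambda>w. ennreal ((norm (fst w - p - ?\<eta> *\<^sub>R (clip c (grad (fst w) (fst (snd w))) + snd (snd w))))\<^sup>2)"
  let ?N = "restrict_space borel X \<Otimes>\<^sub>M (restrict_space borel S \<Otimes>\<^sub>M (borel :: 'a measure))"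
  have id: "(\<lambda>x. x) \<in> restrict_space borel U \<rightarrow>\<^sub>M borel" for U :: "'b::topological_space set"
    by (simp add: measurable_restrict_space1)
  have x[measurable]: "fst \<in> ?N \<rightarrow>\<^sub>M borel"
    by (rule measurable_compose[OF measurable_fst id])
  have z: "(\<lambda>w. fst (snd w)) \<in> ?N \<rightarrow>\<^sub>M borel"
    by (rule measurable_compose[OF _ id]) measurable
  have [measurable]: "(\<lambda>w. grad (fst w) (fst (snd w))) \<in> ?N \<rightarrow>\<^sub>M borel"
    by (rule measurable_grad[OF x _ z]) (auto simp: space_pair_measure space_restrict_space)
  have h: "?h \<in> borel_measurable ?N" by measurable
  have r_int: "integrable M (\<lambda>\<omega>. ?r (\<theta> t \<omega>))"
    using integrable_sq_error by auto
  have r_nonneg: "0 \<le> ?r x" if "x \<in> X" for x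
    using one_step_bound(1)[OF that c_pos \<sigma>_nonneg less_imp_le[OF \<eta>]] by (simp add: add.assoc)
  have "ennreal (mse (Suc t)) = (\<integral>\<^sup>+\<omega>. ennreal ((norm (\<theta> (Suc t) \<omega> - p))\<^sup>2) \<partial>M)"
    unfolding mse_def by (rule nn_integral_eq_integral[symmetric, OF integrable_sq_error]) simp
  also have "\<dots> \<le> (\<integral>\<^sup>+\<omega>. ?h (\<theta> t \<omega>, Z (Suc t) \<omega>, \<zeta> (Suc t) \<omega>) \<partial>M)"
  proof (rule nn_integral_mono)
    fix \<omega> assume w: "\<omega> \<in> space M"
    let ?u = "\<theta> t \<omega> - ?\<eta> *\<^sub>R (clip c (grad (\<theta> t \<omega>) (Z (Suc t) \<omega>)) + \<zeta> (Suc t) \<omega>)"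
    have "norm (\<theta> (Suc t) \<omega> - p) = dist (closest_point X ?u) (closest_point X p)"
      by (simp add: iterate_Suc[OF w] closest_point_self stable_in_X dist_norm)
    also have "\<dots> \<le> dist ?u p"
      by (rule closest_point_lipschitz[OF convex_X closed_X X_nonempty])
    finally show "ennreal ((norm (\<theta> (Suc t) \<omega> - p))\<^sup>2) \<le> ?h (\<theta> t \<omega>, Z (Suc t) \<omega>, \<zeta> (Suc t) \<omega>)"
      by (intro ennreal_leI power_mono) (auto simp: dist_norm algebra_simps)
  qed
  also have "\<dots> = (\<integral>\<^sup>+\<omega>. \<integral>\<^sup>+w. ?h (\<theta> t \<omega>, w) \<partial>step_law (\<theta> t \<omega>) \<partial>M)"
    by (rule nn_integral_step[OF h])
  also have "\<dots> \<le> (\<integral>\<^sup>+\<omega>. ennreal (?r (\<theta> t \<omega>)) \<partial>M)"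
    using one_step_bound(2)[OF iterate_in_X c_pos \<sigma>_nonneg less_imp_le[OF \<eta>]]
    by (intro nn_integral_mono) (simp add: add.assoc)
  also have "\<dots> = ennreal (\<integral>\<omega>. ?r (\<theta> t \<omega>) \<partial>M)"
    by (rule nn_integral_eq_integral[OF r_int]) (use r_nonneg iterate_in_X in auto)
  finally have "mse (Suc t) \<le> (\<integral>\<omega>. ?r (\<theta> t \<omega>) \<partial>M)"
    by (rule ennreal_le_iff[THEN iffD1, rotated])
      (intro integral_nonneg_AE AE_I2 r_nonneg iterate_in_X)
  also have "\<dots> = (1 - margin * ?\<eta>) * mse t + ?b"
    using integrable_sq_error by (simp add: mse_def prob_space)
  finally show ?thesis by (simp add: add.assoc)
qed

end

section \<open>Solving the recursion\<close>

text \<open>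
  Induction on \<open>s\<close>. If \<open>m * \<gamma> (Suc s) \<le> 1\<close>, the recursion may be applied to the induction
  hypothesis, and the step-size ratio condition is exactly what makes the noise term reproduce itself:
  \<open>(1 - m g) (1 + m g / 2) \<le> 1 - m g / 2\<close>. Otherwise the factor is negative, and the a priori bound
  \<open>c1 / m\<^sup>2\<close> suffices: the product has modulus at most \<open>1\<close>, so its term is at least \<open>- c1 / m\<^sup>2\<close>,
  while the step-size term is at least \<open>2 * c1 / m\<^sup>2\<close>.
\<close>

lemma clipped_recursion_bound:
  fixes a \<gamma> :: "nat \<Rightarrow> real" and m c1 C :: real
  assumes m: "m > 0" and c1: "c1 \<ge> 0" and C: "C \<ge> 0"
    and a0: "0 \<le> a 0"
    and bounded: "\<And>s. a s \<le> c1 / m\<^sup>2"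
    and recursion: "\<And>s. a (Suc s) \<le> (1 - m * \<gamma> (Suc s)) * a s + (\<gamma> (Suc s))\<^sup>2 * c1 + \<gamma> (Suc s) * C / m"
    and pos: "\<And>s. s \<ge> 1 \<Longrightarrow> \<gamma> s > 0"
    and ratio: "\<And>s. s \<ge> 2 \<Longrightarrow> \<gamma> (s - 1) / \<gamma> s \<le> 1 + m / 2 * \<gamma> s"
    and le: "\<And>s. s \<ge> 1 \<Longrightarrow> \<gamma> s \<le> 2 / m"
  shows "a (Suc s) \<le> (\<Prod>i=1..Suc s. 1 - m * \<gamma> i) * a 0 + 2 * c1 / m * \<gamma> (Suc s) + 8 * C / m\<^sup>2"
proof -
  define Q where "Q s = (\<Prod>i=1..s. 1 - m * \<gamma> i)" for s :: nat
  have Q_Suc: "Q (Suc s) = (1 - m * \<gamma> (Suc s)) * Q s" for s by (simp add: Q_def)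
  have large: "a (Suc s) \<le> Q (Suc s) * a 0 + 2 * c1 / m * \<gamma> (Suc s) + 8 * C / m\<^sup>2"
    if "m * \<gamma> (Suc s) > 1" for s
  proof -
    have "\<bar>Q (Suc s)\<bar> \<le> 1"
    proof -
      have "\<bar>1 - m * \<gamma> i\<bar> \<le> 1" if "i \<ge> 1" for i
        using pos[OF that] le[OF that] m by (auto simp: abs_le_iff field_simps)
      then show ?thesis unfolding Q_def abs_prod by (intro prod_le_1) auto
    qed
    then have "- a 0 \<le> Q (Suc s) * a 0"
      using mult_right_mono[of "-1" "Q (Suc s)" "a 0"] a0 by (simp add: abs_le_iff)
    moreover have "2 * c1 / m\<^sup>2 \<le> 2 * c1 / m * \<gamma> (Suc s)"
    proof -
      have "2 * c1 / m\<^sup>2 * 1 \<le> 2 * c1 / m\<^sup>2 * (m * \<gamma> (Suc s))"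
        using that c1 by (intro mult_left_mono) auto
      then show ?thesis using m by (simp add: power2_eq_square)
    qed
    moreover have "0 \<le> 8 * C / m\<^sup>2" using C by simp
    ultimately show ?thesis using bounded[of 0] bounded[of "Suc s"] by simp
  qed
  have "a (Suc s) \<le> Q (Suc s) * a 0 + 2 * c1 / m * \<gamma> (Suc s) + 8 * C / m\<^sup>2"
  proof (induction s)
    case 0
    show ?case
    proof (cases "m * \<gamma> (Suc 0) > 1")
      case False
      have g: "\<gamma> 1 > 0" "\<gamma> 1 \<le> 2 / m" using pos le by auto
      have "\<gamma> 1 * \<gamma> 1 * c1 \<le> (2 / m) * \<gamma> 1 * c1"
        using g c1 by (intro mult_right_mono) auto
      moreover have "\<gamma> 1 * C / m \<le> (2 / m) * C / m"
        using g C m by (intro divide_right_mono mult_right_mono) auto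
      moreover have "(2 / m) * C / m \<le> 8 * C / m\<^sup>2"
        using C m by (simp add: power2_eq_square divide_right_mono)
      ultimately show ?thesis
        using recursion[of 0] by (simp add: Q_def power2_eq_square mult_ac)
    qed (rule large)
  next
    case (Suc s)
    show ?case
    proof (cases "m * \<gamma> (Suc (Suc s)) > 1")
      case False
      define g where "g = \<gamma> (Suc (Suc s))"
      have g: "g > 0" "m * g \<le> 1" using False pos by (auto simp: g_def)
      have "\<gamma> (Suc s) / g \<le> 1 + m / 2 * g"
        using ratio[of "Suc (Suc s)"] by (simp add: g_def)
      then have r: "\<gamma> (Suc s) \<le> g * (1 + m / 2 * g)"
        using g by (simp add: field_simps)
      have "a (Suc (Suc s)) \<le> (1 - m * g) * a (Suc s) + g\<^sup>2 * c1 + g * C / m"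
        using recursion[of "Suc s"] by (simp add: g_def)
      also have "\<dots> \<le> (1 - m * g) * (Q (Suc s) * a 0 + 2 * c1 / m * \<gamma> (Suc s) + 8 * C / m\<^sup>2)
          + g\<^sup>2 * c1 + g * C / m"
        using g Suc.IH by (intro add_right_mono mult_left_mono) auto
      also have "\<dots> = Q (Suc (Suc s)) * a 0 + ((1 - m * g) * (2 * c1 / m * \<gamma> (Suc s)) + g\<^sup>2 * c1)
          + ((1 - m * g) * (8 * C / m\<^sup>2) + g * C / m)"
        by (simp add: Q_Suc[of "Suc s"] g_def algebra_simps)
      also have "\<dots> \<le> Q (Suc (Suc s)) * a 0 + 2 * c1 / m * g + 8 * C / m\<^sup>2"
      proof (intro add_mono order_refl)
        have "(1 - m * g) * (2 * c1 / m * \<gamma> (Suc s)) \<le> (1 - m * g) * (2 * c1 / m * (g * (1 + m / 2 * g)))"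
          using g c1 m r by (intro mult_left_mono) auto
        also have "\<dots> = 2 * c1 / m * g - g\<^sup>2 * c1 - g\<^sup>2 * c1 * (m * g)"
          using m by (simp add: field_simps power2_eq_square)
        also have "\<dots> \<le> 2 * c1 / m * g - g\<^sup>2 * c1" using c1 m g by simp
        finally show "(1 - m * g) * (2 * c1 / m * \<gamma> (Suc s)) + g\<^sup>2 * c1 \<le> 2 * c1 / m * g" by simp
        have "(1 - m * g) * (8 * C / m\<^sup>2) + g * C / m = 8 * C / m\<^sup>2 - 7 * (g * C / m)"
          using m by (simp add: field_simps power2_eq_square)
        also have "\<dots> \<le> 8 * C / m\<^sup>2" using g C m by simp
        finally show "(1 - m * g) * (8 * C / m\<^sup>2) + g * C / m \<le> 8 * C / m\<^sup>2" .
      qed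
      finally show ?thesis by (simp add: g_def)
    qed (rule large)
  qed
  then show ?thesis by (simp add: Q_def)
qed

section \<open>Convergence\<close>

theorem theorem3:
  fixes X :: "'a::euclidean_space set"
    and S :: "'z::euclidean_space set"
    and loss :: "'a \<Rightarrow> 'z \<Rightarrow> real"
    and D :: "'a \<Rightarrow> 'z measure"
    and M :: "'w measure"
    and Z :: "nat \<Rightarrow> 'w \<Rightarrow> 'z"
    and \<zeta> \<theta> :: "nat \<Rightarrow> 'w \<Rightarrow> 'a"
    and \<theta>0 \<theta>PS :: 'a
    and \<gamma> :: "nat \<Rightarrow> real"
    and \<mu> L G \<beta> c \<sigma> :: real
    and t :: nat
  assumes "closed X" and "convex X"
    and "\<And>x. x \<in> X \<Longrightarrow> prob_space (D x)"
    and "\<And>x. x \<in> X \<Longrightarrow> sets (D x) = sets (restrict_space borel S)"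
    and "\<And>x z. x \<in> X \<Longrightarrow> z \<in> S \<Longrightarrow> (\<lambda>u. loss u z) differentiable (at x)"
    and "\<And>x y. x \<in> X \<Longrightarrow> y \<in> X \<Longrightarrow> integrable (D y) (loss x)"
    \<comment> \<open>(S)\<close>
    and "\<mu> > 0"
    and "\<And>x. x \<in> X \<Longrightarrow> strongly_convex_on \<mu> X (\<lambda>u. decoupled_risk loss D u x)"
    \<comment> \<open>(L)\<close>
    and "\<And>x1 x2 z1 z2. x1 \<in> X \<Longrightarrow> x2 \<in> X \<Longrightarrow> z1 \<in> S \<Longrightarrow> z2 \<in> S \<Longrightarrow>
      norm (gradient (\<lambda>u. loss u z1) x1 - gradient (\<lambda>u. loss u z2) x2)
        \<le> L * (norm (x1 - x2) + norm (z1 - z2))"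
    and "\<exists>l. \<forall>x\<in>X. \<forall>z\<in>S. loss x z \<ge> l"
    \<comment> \<open>(B)\<close>
    and "\<And>x z. x \<in> X \<Longrightarrow> z \<in> S \<Longrightarrow> norm (gradient (\<lambda>u. loss u z) x) \<le> G"
    \<comment> \<open>(W)\<close>
    and "\<beta> \<ge> 0"
    and "\<And>x y. x \<in> X \<Longrightarrow> y \<in> X \<Longrightarrow> W1 (D x) (D y) \<le> ennreal (\<beta> * norm (x - y))"
    and "\<beta> < \<mu> / L"
    and "\<And>s. s \<ge> 1 \<Longrightarrow> \<gamma> s > 0"
    and "\<And>s. s \<ge> 1 \<Longrightarrow> \<gamma> (s + 1) \<le> \<gamma> s"
    and "\<And>s. s \<ge> 2 \<Longrightarrow> \<gamma> (s - 1) / \<gamma> s \<le> 1 + (\<mu> - L * \<beta>) / 2 * \<gamma> s"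
    and "\<And>s. s \<ge> 1 \<Longrightarrow> \<gamma> s \<le> 2 / (\<mu> - L * \<beta>)"
    and "c > 0" and "\<sigma> \<ge> 0"
    and "\<theta>0 \<in> X"
    and "prob_space M"
    and "projected_clipped_sgd M X S loss D \<gamma> c \<sigma> \<theta>0 Z \<zeta> \<theta>"
    and "performatively_stable X loss D \<theta>PS"
    and "t \<ge> 1"
  shows "let \<mu>' = \<mu> - L * \<beta>;
             c1 = 2 * (c\<^sup>2 + G\<^sup>2) + real DIM('a) * \<sigma>\<^sup>2;
             C1 = (max (G - c) 0)\<^sup>2
         in integrable M (\<lambda>\<omega>. (norm (\<theta> (t + 1) \<omega> - \<theta>PS))\<^sup>2) \<and>
            (\<integral>\<omega>. (norm (\<theta> (t + 1) \<omega> - \<theta>PS))\<^sup>2 \<partial>M)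
              \<le> (\<Prod>i=1..t + 1. 1 - \<mu>' * \<gamma> i) * (norm (\<theta>0 - \<theta>PS))\<^sup>2
                + 2 * c1 / \<mu>' * \<gamma> (t + 1) + 8 * C1 / \<mu>'\<^sup>2"
proof -
  \<comment> \<open>A nonpositive \<open>L\<close> (including \<open>\<mu> / 0 = 0\<close>) is ruled out by \<open>0 \<le> \<beta> < \<mu> / L\<close>.\<close>
  have L: "L > 0"
  proof (rule ccontr)
    assume "\<not> L > 0"
    then have "\<mu> / L \<le> 0" using \<open>\<mu> > 0\<close> by (simp add: divide_nonneg_nonpos)
    then show False using \<open>\<beta> \<ge> 0\<close> \<open>\<beta> < \<mu> / L\<close> by linarith
  qed
  have contraction: "L * \<beta> < \<mu>" using \<open>\<beta> < \<mu> / L\<close> L by (simp add: field_simps)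
  interpret performative_risk X S loss D \<mu> L G \<beta> \<theta>PS
    by (rule performative_risk.intro; fact)
  interpret clipped_sgd X S loss D \<mu> L G \<beta> \<theta>PS M \<gamma> c \<sigma> \<theta>0 Z \<zeta> \<theta>
    by (intro clipped_sgd.intro clipped_sgd_axioms.intro performative_risk_axioms \<open>prob_space M\<close>) fact+
  define c1 where "c1 = 2 * (c\<^sup>2 + G\<^sup>2) + real DIM('a) * \<sigma>\<^sup>2"
  have c1: "c1 \<ge> 0" "G\<^sup>2 \<le> c1" "c\<^sup>2 + real DIM('a) * \<sigma>\<^sup>2 \<le> c1" by (auto simp: c1_def)
  have "mse (Suc t) \<le> (\<Prod>i=1..Suc t. 1 - margin * \<gamma> i) * mse 0
      + 2 * c1 / margin * \<gamma> (Suc t) + 8 * (max (G - c) 0)\<^sup>2 / margin\<^sup>2"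
  proof (rule clipped_recursion_bound[OF margin_pos c1(1)])
    show "mse s \<le> c1 / margin\<^sup>2" for s
    proof -
      have "mse s \<le> G\<^sup>2 / margin\<^sup>2" using mse_le by (simp add: power_divide)
      also have "\<dots> \<le> c1 / margin\<^sup>2" using c1 by (intro divide_right_mono) auto
      finally show ?thesis .
    qed
    show "mse (Suc s) \<le> (1 - margin * \<gamma> (Suc s)) * mse s + (\<gamma> (Suc s))\<^sup>2 * c1
        + \<gamma> (Suc s) * (max (G - c) 0)\<^sup>2 / margin" for s
    proof -
      have "(\<gamma> (Suc s))\<^sup>2 * (c\<^sup>2 + real DIM('a) * \<sigma>\<^sup>2) \<le> (\<gamma> (Suc s))\<^sup>2 * c1"
        using c1 by (intro mult_left_mono) auto
      then show ?thesis using mse_recursion[of s] by linarith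
    qed
  qed (use assms in \<open>auto simp: mse_0 margin_def\<close>)
  then show ?thesis
    using integrable_sq_error[of "Suc t"]
    by (simp only: Let_def mse_0) (simp add: mse_def margin_def c1_def)
qed

end
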